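(* Let $X=X(\mathbb T)$ be a Banach lattice on $\mathbb T$ satisfying Assumption A, and let $D_n(x)=\sum_{k=-n}^n e^{ikx}$ be the Dirichlet kernel. Suppose that $$\sup_{n\in\mathbb N}\ \sup_{\|f\|_X\le1}\|f*D_n\|_X<\infty .$$ For $n\in\mathbb N$ let $$K_n^{\varphi_1}f(x)=\frac1{2n+1}\sum_{k=0}^{2n}A_{\gamma/n}f(t_k)\,D_n(x-t_k),\qquad t_k=\frac{2\pi k}{2n+1}.$$ Then for all $f\in X$ and $n\in\mathbb N$ $$\|f-K_n^{\varphi_1}f\|_X\asymp\|(I-A_{\gamma/n})f\|_X,$$ where $\asymp$ denotes a two-sided inequality with positive constants independent of $f$ and $n$.
   Context: **Banach lattice.** $\mathbb T$ is the unit circle, identified with $[-\pi,\pi)$ (functions are $2\pi$-periodic), and $\mu$ is the normalized Lebesgue measure on $\mathbb T$. A Banach lattice $X$ on $\mathbb T$ is a Banach space of measurable functions on $\mathbb T$ with norm $\|\cdot\|_X$ such that: (1) if $f$ is measurable, $g\in X$ and $|f|\le|g|$, then $f\in X$ and $\|f\|_X\le\|g\|_X$; (2) if $f_n\in X$, $\sup_n\|f_n\|_X<\infty$ and $0\le f_n\uparrow f$, then $f\in X$ and $\|f_n\|_X\to\|f\|_X$; (3) if $E\subset\mathbb T$ is measurable with $\mu(E)<\infty$, then $\chi_E\in X$ and there is $c_E>0$ with $\int_E|f|\,d\mu\le c_E\|f\|_X$ for all $f\in X$. **Steklov averages.** For locally integrable $f$ and $h>0$: $A_hf(x)=\frac1h\int_{x-h/2}^{x+h/2}f(t)\,dt$.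 **Assumption A.** For all $f\in X$ and $h>0$, $A_hf\in X$, and $\sup_{h>0}\sup_{\|f\|_X\le1}\|A_hf\|_X<\infty$. **Convolution.** $(f*g)(x)=\int_{\mathbb T}f(t)g(x-t)\,d\mu(t)$. **Parameter $\gamma$.** $\gamma>0$ is a fixed constant satisfying the standing separation condition $\gamma/n\le t_{k+1}-t_k=\frac{2\pi}{2n+1}$ for all $n\in\mathbb N$ (e.g. $\gamma=1$). *)

theory Defs
  imports "HOL-Analysis.Analysis" "HOL-Library.Periodic_Fun"
begin

text \<open>
  A function on the circle is a \<open>2\<pi>\<close>-periodic function on the real line; accordingly, a subset of
  the circle is a \<open>2\<pi>\<close>-periodic subset of the real line.
\<close>

definition circle_measure :: "real measure" where
  "circle_measure = uniform_measure lebesgue {-pi..<pi}"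

definition circle_measurable :: "(real \<Rightarrow> complex) set" where
  "circle_measurable = {f. periodic_fun_simple f (2 * pi) \<and> f \<in> borel_measurable lebesgue}"

text \<open>
  \<open>X\<close> consists of representatives: two functions that agree almost everywhere are the same
  element of the Banach space, so that \<open>N\<close> is a norm modulo equality almost everywhere and all
  pointwise relations are required only almost everywhere.
  The values of \<open>N\<close> outside \<open>X\<close> are irrelevant.
\<close>

locale banach_lattice_on_circle =
  fixes X :: "(real \<Rightarrow> complex) set" and N :: "(real \<Rightarrow> complex) \<Rightarrow> real"
  assumes measurable: "X \<subseteq> circle_measurable"
    and add_closed: "f \<in> X \<Longrightarrow> g \<in> X \<Longrightarrow> (\<lambda>x. f x + g x) \<in> X"
    and scale_closed: "f \<in> X \<Longrightarrow> (\<lambda>x. c * f x) \<in> X"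
    and norm_nonneg: "f \<in> X \<Longrightarrow> 0 \<le> N f"
    and norm_eq_0_iff: "f \<in> X \<Longrightarrow> N f = 0 \<longleftrightarrow> (AE x in circle_measure. f x = 0)"
    and norm_scale: "f \<in> X \<Longrightarrow> N (\<lambda>x. c * f x) = cmod c * N f"
    and norm_triangle: "f \<in> X \<Longrightarrow> g \<in> X \<Longrightarrow> N (\<lambda>x. f x + g x) \<le> N f + N g"
    and complete:
      "(\<And>n. F n \<in> X) \<Longrightarrow>
       (\<And>e. e > 0 \<Longrightarrow> \<exists>M. \<forall>m\<ge>M. \<forall>n\<ge>M. N (\<lambda>x. F m x - F n x) < e) \<Longrightarrow>
       \<exists>f\<in>X. (\<lambda>n::nat. N (\<lambda>x. F n x - f x)) \<longlonglongrightarrow> 0"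
    and ideal:
      "f \<in> circle_measurable \<Longrightarrow> g \<in> X \<Longrightarrow>
       (AE x in circle_measure. cmod (f x) \<le> cmod (g x)) \<Longrightarrow> f \<in> X \<and> N f \<le> N g"
    and monotone_convergence:
      "(\<And>n. (\<lambda>x. complex_of_real (u n x)) \<in> X) \<Longrightarrow>
       bdd_above (range (\<lambda>n. N (\<lambda>x. complex_of_real (u n x)))) \<Longrightarrow>
       (\<lambda>x. complex_of_real (v x)) \<in> circle_measurable \<Longrightarrow>
       (AE x in circle_measure.
          (\<forall>n. 0 \<le> u n x) \<and> incseq (\<lambda>n. u n x) \<and> (\<lambda>n::nat. u n x) \<longlonglongrightarrow> v x) \<Longrightarrow>
       (\<lambda>x. complex_of_real (v x)) \<in> X \<and>
       (\<lambda>n. N (\<lambda>x. complex_of_real (u n x))) \<longlonglongrightarrow> N (\<lambda>x. complex_of_real (v x))"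
    and indicator_mem:
      "indicator E \<in> circle_measurable \<Longrightarrow> emeasure circle_measure E < \<infinity> \<Longrightarrow> indicator E \<in> X"
    and integral_bound:
      "indicator E \<in> circle_measurable \<Longrightarrow> emeasure circle_measure E < \<infinity> \<Longrightarrow>
       \<exists>c>0. \<forall>f\<in>X. (\<integral>\<^sup>+x\<in>E. ennreal (cmod (f x)) \<partial>circle_measure) \<le> ennreal (c * N f)"

text \<open>
  The integral is taken with respect to \<^const>\<open>lebesgue\<close> because the functions considered need
  not be Borel measurable.
\<close>

definition steklov :: "real \<Rightarrow> (real \<Rightarrow> complex) \<Rightarrow> real \<Rightarrow> complex" where
  "steklov h f x = complex_of_real (1 / h) * (LINT t:{x - h/2..x + h/2}|lebesgue. f t)"

definition assumption_A :: "(real \<Rightarrow> complex) set \<Rightarrow> ((real \<Rightarrow> complex) \<Rightarrow> real) \<Rightarrow> bool" where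
  "assumption_A X N \<longleftrightarrow>
     (\<forall>f\<in>X. \<forall>h>0. steklov h f \<in> X) \<and>
     (SUP h\<in>{0<..}. SUP f\<in>{f \<in> X. N f \<le> 1}. ereal (N (steklov h f))) < \<infinity>"

definition convolution :: "(real \<Rightarrow> complex) \<Rightarrow> (real \<Rightarrow> complex) \<Rightarrow> real \<Rightarrow> complex" where
  "convolution f g x = (LINT t|circle_measure. f t * g (x - t))"

definition dirichlet_kernel :: "nat \<Rightarrow> real \<Rightarrow> complex" where
  "dirichlet_kernel n x = (\<Sum>k = - int n..int n. exp (\<i> * of_int k * complex_of_real x))"

definition node :: "nat \<Rightarrow> nat \<Rightarrow> real" where
  "node n k = 2 * pi * real k / (2 * real n + 1)"

definition sampling_operator :: "real \<Rightarrow> nat \<Rightarrow> (real \<Rightarrow> complex) \<Rightarrow> real \<Rightarrow> complex" where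
  "sampling_operator \<gamma> n f x =
     1 / of_nat (2 * n + 1) *
     (\<Sum>k = 0..2 * n. steklov (\<gamma> / real n) f (node n k) * dirichlet_kernel n (x - node n k))"

end

theory Submission
  imports Defs
begin

text \<open>
  Write \<open>h = \<gamma> / n\<close>, \<open>A\<close> for the Steklov average of width \<open>h\<close>, \<open>S\<close> for the Fourier partial sum of
  order \<open>n\<close> (convolution with the Dirichlet kernel) and \<open>K\<close> for the sampling operator. On
  exponentials \<open>A\<close> is diagonal: it multiplies the \<open>k\<close>-th one by \<open>sinc (k h / 2)\<close>. Moreover \<open>K f\<close> is
  the trigonometric polynomial of degree at most \<open>n\<close> that interpolates \<open>A f\<close> at the nodes, so \<open>K T = A T\<close>
  for every polynomial \<open>T\<close> of degree at most \<open>n\<close>. Both halves of the equivalence then come from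
  algebra and two uniform bounds.

  Lower half: with \<open>u = f - K f\<close> one has \<open>K (K f) = A (K f)\<close>, hence
  \<open>f - A f = (u - A u) + K u\<close>, and it suffices that \<open>K\<close> is bounded on \<open>X\<close> uniformly in \<open>n\<close>.
  Upper half: with \<open>v = f - S f\<close> one has \<open>f - K f = (v - K v) + S (f - A f)\<close>, and it remains to
  bound \<open>v\<close> by \<open>f - A f\<close>.

  The only source of multiplier theorems is summation by parts: an even multiplier with
  coefficients \<open>a\<^sub>0, \<dots>, a\<^sub>M\<close> is a combination of partial sums whose weights are the increments of
  \<open>a\<close> and the last value \<open>a\<^sub>M\<close>. As the partial sums are uniformly bounded by hypothesis, the norm of
  the multiplier is at most a constant times the total variation of \<open>a\<close> plus \<open>\<bar>a\<^sub>M\<bar>\<close>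
  (\<open>multiplier_bound\<close>).

  Boundedness of \<open>K\<close> (\<open>sampling_operator_bounded\<close>): the arcs of length \<open>h\<close> around the nodes are
  disjoint by the separation condition on \<open>\<gamma>\<close>. Let \<open>E f\<close> be the step function equal
  to the mean of \<open>f\<close> on each arc and to zero elsewhere. It is dominated pointwise by twice the
  Steklov average of \<open>\<bar>f\<bar>\<close> of width \<open>2 h\<close>, so \<open>E\<close> is bounded on the lattice \<open>X\<close>. The Fourier coefficients of \<open>E f\<close>
  are, up to a factor bounded above and below independently of \<open>n\<close>, those of \<open>K f\<close> times \<open>sinc (k h / 2)\<close>; therefore \<open>K f\<close>
  is obtained from \<open>E f\<close> by the multiplier \<open>1 / sinc (k h / 2)\<close>, \<open>\<bar>k\<bar> \<le> n\<close>, which is monotone in \<open>\<bar>k\<bar>\<close>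
  and bounded.

  Bound for \<open>v\<close> (\<open>fourier_remainder_bound\<close>): put \<open>G = v - A v\<close>, which equals
  \<open>(f - A f) - S (f - A f)\<close> and so is controlled by \<open>f - A f\<close>. Inverting \<open>I - A\<close> on frequencies above
  \<open>n\<close> directly would need the multiplier \<open>1 / (1 - sinc)\<close>, which has infinite variation. Instead
  \<open>v = G + A G + A (A v)\<close>, and \<open>w = A (A v)\<close> arises from \<open>G\<close> by the multiplier
  \<open>sinc\<^sup>2 / (1 - sinc)\<close>, whose derivative decays quadratically. This bounds all partial sums of \<open>w\<close>.
  As \<open>w\<close> is continuous, it is a uniform limit of trigonometric polynomials, so its partial sums
  converge to it in \<open>X\<close> (\<open>norm_le_of_fourier_sums\<close>); this is needed because trigonometric
  polynomials may fail to be dense in \<open>X\<close>.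
\<close>

section \<open>Integrable functions on the circle\<close>

definition circle_integrable :: "(real \<Rightarrow> complex) \<Rightarrow> bool" where
  "circle_integrable f \<longleftrightarrow>
     f \<in> circle_measurable \<and> f absolutely_integrable_on {-pi..pi}"

lemma periodic_add_int:
  fixes f :: "real \<Rightarrow> 'a"
  assumes "\<And>x. f (x + 2 * pi) = f x"
  shows "f (x + 2 * pi * of_int m) = f x"
proof -
  interpret periodic_fun_simple f "2 * pi" using assms by unfold_locales
  show ?thesis using plus_of_int[of x m] by (simp add: mult.commute)
qed

lemma absolutely_integrable_translate:
  fixes f :: "real \<Rightarrow> complex"
  assumes "f absolutely_integrable_on {a + c..b + c}"
  shows "(\<lambda>x. f (x + c)) absolutely_integrable_on {a..b}"
proof -
  have "f integrable_on {a + c..b + c}" "(\<lambda>x. norm (f x)) integrable_on {a + c..b + c}"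
    using assms by (auto simp: absolutely_integrable_on_def)
  then have "(\<lambda>x. f (x + c)) integrable_on {a..b}" "(\<lambda>x. norm (f (x + c))) integrable_on {a..b}"
    using has_integral_shift_Icc_real[of f c _ a b] has_integral_shift_Icc_real[of "\<lambda>x. norm (f x)" c _ a b]
    by (auto simp: integrable_on_def o_def add.commute[of c])
  then show ?thesis by (simp add: absolutely_integrable_on_def)
qed

lemma circle_integrable_measurable [simp]:
  "circle_integrable f \<Longrightarrow> f \<in> borel_measurable lebesgue"
  by (simp add: circle_integrable_def circle_measurable_def)

lemma circle_integrable_periodic: "circle_integrable f \<Longrightarrow> f (x + 2 * pi) = f x"
  unfolding circle_integrable_def circle_measurable_def periodic_fun_simple_def by blast

lemma circle_integrableI:
  assumes "\<And>x. f (x + 2 * pi) = f x" "f \<in> borel_measurable lebesgue"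
    and "f absolutely_integrable_on {-pi..pi}"
  shows "circle_integrable f"
  using assms unfolding circle_integrable_def circle_measurable_def periodic_fun_simple_def by blast

text \<open>
  A bounded interval is covered by finitely many translates of one period; the induction adds one
  period on either side.
\<close>

lemma circle_integrable_on [intro]:
  assumes "circle_integrable f"
  shows "f absolutely_integrable_on {a..b}"
proof -
  have per: "f (x + 2 * pi) = f x" for x
    using assms by (rule circle_integrable_periodic)
  have int: "f absolutely_integrable_on {-pi..pi}"
    using assms by (simp add: circle_integrable_def)
  have sym: "f absolutely_integrable_on {-pi - 2*pi*real m..pi + 2*pi*real m}" for m
  proof (induction m)
    case 0
    then show ?case using int by simp
  next
    case (Suc m)
    let ?c = "2*pi*real m" 
    have 1: "f absolutely_integrable_on {-pi - 2*pi*real (Suc m)..pi - 2*pi*real (Suc m)}"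
    proof -
      have "(\<lambda>x. f (x + 2*pi*real (Suc m))) absolutely_integrable_on
              {-pi - 2*pi*real (Suc m)..pi - 2*pi*real (Suc m)}"
        by (rule absolutely_integrable_translate) (use int in simp)
      moreover have "f (x + 2*pi*real (Suc m)) = f x" for x
        using periodic_add_int[of f, OF per, of x "int (Suc m)"] by simp
      ultimately show ?thesis by simp
    qed
    have 2: "f absolutely_integrable_on {-pi + 2*pi*real (Suc m)..pi + 2*pi*real (Suc m)}"
    proof -
      have "(\<lambda>x. f (x + - (2*pi*real (Suc m)))) absolutely_integrable_on
              {-pi + 2*pi*real (Suc m)..pi + 2*pi*real (Suc m)}"
        by (rule absolutely_integrable_translate) (use int in simp)
      moreover have "f (x + - (2*pi*real (Suc m))) = f x" for x
        using periodic_add_int[of f, OF per, of "x + - (2*pi*real (Suc m))" "int (Suc m)"] by (simp add: algebra_simps)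
      ultimately show ?thesis by simp
    qed
    have split: "{-pi - 2*pi*real (Suc m)..pi + 2*pi*real (Suc m)} \<subseteq>
       {-pi - 2*pi*real (Suc m)..pi - 2*pi*real (Suc m)} \<union> ({-pi - ?c..pi + ?c} \<union>
       {-pi + 2*pi*real (Suc m)..pi + 2*pi*real (Suc m)})"
      by (auto simp: algebra_simps)
    show ?case
      by (rule set_integrable_subset[OF absolutely_integrable_Un[OF 1 absolutely_integrable_Un[OF Suc 2]] _ split])
         auto
  qed
  obtain m where m: "max \<bar>a\<bar> \<bar>b\<bar> < real m" using reals_Archimedean2 by blast
  have "real m \<le> pi * real m" using pi_ge_two by (simp add: mult_le_cancel_right1)
  then have "real m \<le> pi + 2*pi*real m"
    using pi_gt_zero mult_nonneg_nonneg[of pi "real m"] by linarith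
  then have sub: "{a..b} \<subseteq> {-pi - 2*pi*real m..pi + 2*pi*real m}"
    using m by auto
  have "{a..b} \<in> sets lebesgue" by simp
  from set_integrable_subset[OF sym this sub] show ?thesis .
qed

lemma circle_integrable_on' [intro, simp]: "circle_integrable f \<Longrightarrow> f integrable_on {a..b}"
  by (rule set_lebesgue_integral_eq_integral(1)[OF circle_integrable_on])

text \<open>
  Moving the left end point from \<open>a\<close> to \<open>b\<close> within one period removes \<open>{a..b}\<close> and adds its translate
  by \<open>2 * pi\<close>. An arbitrary \<open>a\<close> is first brought within one period of \<open>- pi\<close>.
\<close>

lemma integral_period:
  assumes f: "circle_integrable f"
  shows "integral {a..a + 2 * pi} f = integral {-pi..pi} f"
proof -
  have shift: "integral {a + 2*pi * of_int m..b + 2*pi * of_int m} f = integral {a..b} f" for a b and m :: int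
  proof -
    have "f \<circ> (\<lambda>x. x + 2*pi * of_int m) = f"
      using periodic_add_int[of f, OF circle_integrable_periodic[OF f]] by auto
    then show ?thesis
      using integral_shift_Icc_real[of a b f "2*pi * of_int m"]
      by (simp add: o_def add.commute fun_eq_iff)
  qed
  have step: "integral {a..a + 2*pi} f = integral {b..b + 2*pi} f" if "a \<le> b" "b \<le> a + 2*pi" for a b
  proof -
    have "integral {a..b} f + integral {b..a+2*pi} f = integral {a..a+2*pi} f"
      using that f by (intro Henstock_Kurzweil_Integration.integral_combine) auto
    moreover have "integral {b..a+2*pi} f + integral {a+2*pi..b+2*pi} f = integral {b..b+2*pi} f"
      using that f by (intro Henstock_Kurzweil_Integration.integral_combine) auto
    ultimately show ?thesis using shift[of a 1 b] by (simp add: add.commute)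
  qed
  define m where "m = \<lfloor>(a + pi) / (2*pi)\<rfloor>"
  define r where "r = a + pi - 2*pi * of_int m"
  have "of_int m \<le> (a + pi) / (2*pi)" "(a + pi) / (2*pi) < of_int m + 1"
    unfolding m_def by linarith+
  then have r: "0 \<le> r" "r \<le> 2*pi" by (auto simp: r_def field_simps)
  have "integral {a..a + 2*pi} f = integral {(r - pi) + 2*pi * of_int m..(r + pi) + 2*pi * of_int m} f"
    by (simp add: r_def add.commute)
  also have "\<dots> = integral {r - pi..r + pi} f" by (rule shift)
  also have "\<dots> = integral {-pi..pi} f" using step[of "-pi" "r - pi"] r by (simp add: add.commute[of pi])
  finally show ?thesis .
qed

lemma integral_translate_circle:
  assumes f: "circle_integrable f"
  shows "integral {-pi..pi} (\<lambda>x. f (x + s)) = integral {-pi..pi} f"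
proof -
  have "integral {-pi..pi} (\<lambda>x. f (x + s)) = integral {-pi + s..pi + s} f"
    using integral_shift_Icc_real[of "-pi" pi f s] by (simp add: o_def add.commute)
  also have "\<dots> = integral {-pi..pi} f"
    using integral_period[OF f, of "s - pi"] by (simp add: algebra_simps)
  finally show ?thesis .
qed

lemma steklov_eq_integral:
  assumes "circle_integrable f"
  shows "steklov h f x = complex_of_real (1 / h) * integral {x - h/2..x + h/2} f"
  unfolding steklov_def using assms by (subst set_lebesgue_integral_eq_integral(2)) auto

lemma integral_circle_measure:
  fixes g :: "real \<Rightarrow> complex"
  assumes m: "g \<in> borel_measurable lebesgue" and g: "g absolutely_integrable_on {-pi..pi}"
  shows "(LINT t|circle_measure. g t) = integral {-pi..pi} g / (2 * pi)"
proof -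
  have g': "g absolutely_integrable_on {-pi..<pi}"
    by (rule set_integrable_subset[OF g]) auto
  have "circle_measure = density lebesgue (\<lambda>x. ennreal (indicator {-pi..<pi} x / (2*pi)))"
    unfolding circle_measure_def uniform_measure_def
    by (intro density_cong borel_measurable_divide_ennreal borel_measurable_indicator
          measurable_compose[OF _ measurable_ennreal] borel_measurable_divide)
       (auto simp: indicator_def divide_ennreal ennreal_1[symmetric] simp del: ennreal_1)
  then have "(LINT t|circle_measure. g t) = (LINT t|density lebesgue (\<lambda>x. ennreal (indicator {-pi..<pi} x / (2*pi))). g t)"
    by simp
  also have "\<dots> = (LINT t|lebesgue. (indicator {-pi..<pi} t / (2*pi)) *\<^sub>R g t)"
    using m by (intro integral_density borel_measurable_divide borel_measurable_indicator) auto
  also have "\<dots> = (LINT t:{-pi..<pi}|lebesgue. g t) / (2*pi)"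
    unfolding set_lebesgue_integral_def integral_divide_zero[symmetric]
    by (intro Bochner_Integration.integral_cong) (auto simp: scaleR_conv_of_real)
  also have "(LINT t:{-pi..<pi}|lebesgue. g t) = integral {-pi..<pi} g"
    by (rule set_lebesgue_integral_eq_integral(2)[OF g'])
  also have "\<dots> = integral {-pi..pi} g"
    by (rule integral_subset_negligible) (auto intro: negligible_subset[of "{pi}"])
  finally show ?thesis .
qed

section \<open>Fourier coefficients and Steklov averages\<close>

lemma circle_integrable_add [intro]:
  "circle_integrable f \<Longrightarrow> circle_integrable g \<Longrightarrow> circle_integrable (\<lambda>x. f x + g x)"
  by (intro circle_integrableI set_integral_add borel_measurable_add)
     (simp_all add: circle_integrable_periodic circle_integrable_on)

lemma circle_integrable_diff [intro]:
  "circle_integrable f \<Longrightarrow> circle_integrable g \<Longrightarrow> circle_integrable (\<lambda>x. f x - g x)"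
  by (intro circle_integrableI set_integral_diff borel_measurable_diff)
     (simp_all add: circle_integrable_periodic circle_integrable_on)

lemma circle_integrable_mult_left [intro]:
  "circle_integrable f \<Longrightarrow> circle_integrable (\<lambda>x. c * f x)"
  by (intro circle_integrableI set_integrable_mult_right borel_measurable_times borel_measurable_const)
     (simp_all add: circle_integrable_periodic circle_integrable_on)

lemma circle_integrable_mult_continuous:
  assumes f: "circle_integrable f" and u: "continuous_on UNIV u" and per: "\<And>x. u (x + 2 * pi) = u x"
  shows "circle_integrable (\<lambda>x. f x * u x)"
proof -
  have m: "u \<in> borel_measurable borel" using u by (rule borel_measurable_continuous_onI)
  then have ml: "u \<in> borel_measurable lebesgue" by (simp add: measurable_completion)
  have "bounded (u ` {-pi..pi})"
    by (intro compact_imp_bounded compact_continuous_image continuous_on_subset[OF u]) auto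
  then obtain B where B: "\<forall>y\<in>u ` {-pi..pi}. norm y \<le> B"
    unfolding bounded_iff by blast
  have "(\<lambda>x. f x * u x) absolutely_integrable_on {-pi..pi}"
  proof (rule measurable_bounded_by_integrable_imp_absolutely_integrable)
    show "(\<lambda>x. f x * u x) \<in> borel_measurable (lebesgue_on {-pi..pi})"
      using f ml by (intro measurable_restrict_space1 borel_measurable_times) auto
    show "(\<lambda>x. norm (f x) * B) integrable_on {-pi..pi}"
      using f circle_integrable_on[of f "-pi" pi] by (auto simp: absolutely_integrable_on_def intro: integrable_on_mult_left)
    show "norm (f x * u x) \<le> norm (f x) * B" if "x \<in> {-pi..pi}" for x
      using bspec[OF B imageI[OF that]] by (simp add: norm_mult mult_left_mono)
  qed auto
  then show ?thesis
    using f ml per by (intro circle_integrableI borel_measurable_times) (simp_all add: circle_integrable_periodic)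
qed

lemma circle_integrable_const [simp]: "circle_integrable (\<lambda>x. c)"
  by (intro circle_integrableI absolutely_integrable_continuous_real) auto

lemma circle_integrable_continuous:
  assumes u: "continuous_on UNIV u" and per: "\<And>x. u (x + 2 * pi) = u x"
  shows "circle_integrable u"
  using circle_integrable_mult_continuous[OF circle_integrable_const[of 1] u per] by simp

lemma circle_integrable_sum:
  "(\<And>i. i \<in> I \<Longrightarrow> circle_integrable (f i)) \<Longrightarrow> circle_integrable (\<lambda>x. \<Sum>i\<in>I. f i x)"
  by (induction I rule: infinite_finite_induct) auto

lemma cis_int_periodic: "cis (of_int k * (x + 2 * pi)) = cis (of_int k * x)"
  by (simp add: ring_distribs cis_mult[symmetric]) 
     (metis Ints_of_int cis_multiple_2pi mult.commute mult.right_neutral mult.assoc)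

lemma continuous_cis_int: "continuous_on UNIV (\<lambda>x::real. cis (of_int k * x))"
  by (intro continuous_intros)

lemma circle_integrable_cis [intro, simp]: "circle_integrable (\<lambda>x. cis (of_int k * x))"
  by (rule circle_integrable_continuous[OF continuous_cis_int cis_int_periodic])

lemma circle_integrable_mult_cis [intro]:
  "circle_integrable f \<Longrightarrow> circle_integrable (\<lambda>x. f x * cis (of_int k * x))"
  by (rule circle_integrable_mult_continuous[OF _ continuous_cis_int cis_int_periodic])

lemma circle_integrable_mult_cis' [intro]:
  "circle_integrable f \<Longrightarrow> circle_integrable (\<lambda>x. f x * cis (- (of_int k * x)))"
  using circle_integrable_mult_cis[of f "-k"] by simp

definition fourier_coeff :: "(real \<Rightarrow> complex) \<Rightarrow> int \<Rightarrow> complex" where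
  "fourier_coeff f k = integral {-pi..pi} (\<lambda>t. f t * cis (- (of_int k * t))) / (2 * pi)"

lemma fourier_coeff_add:
  "circle_integrable f \<Longrightarrow> circle_integrable g \<Longrightarrow>
   fourier_coeff (\<lambda>x. f x + g x) k = fourier_coeff f k + fourier_coeff g k"
  unfolding fourier_coeff_def
  by (simp add: ring_distribs add_divide_distrib circle_integrable_mult_cis'
        Henstock_Kurzweil_Integration.integral_add)

lemma fourier_coeff_diff:
  "circle_integrable f \<Longrightarrow> circle_integrable g \<Longrightarrow>
   fourier_coeff (\<lambda>x. f x - g x) k = fourier_coeff f k - fourier_coeff g k"
  unfolding fourier_coeff_def
  by (simp add: ring_distribs diff_divide_distrib circle_integrable_mult_cis'
        Henstock_Kurzweil_Integration.integral_diff)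

lemma fourier_coeff_cmult: "fourier_coeff (\<lambda>x. c * f x) k = c * fourier_coeff f k"
  unfolding fourier_coeff_def by (simp add: mult.assoc)

lemma fourier_coeff_zero: "fourier_coeff (\<lambda>x. 0) k = 0"
  unfolding fourier_coeff_def by simp

lemma fourier_coeff_sum:
  "finite I \<Longrightarrow> (\<And>i. i \<in> I \<Longrightarrow> circle_integrable (f i)) \<Longrightarrow>
   fourier_coeff (\<lambda>x. \<Sum>i\<in>I. f i x) k = (\<Sum>i\<in>I. fourier_coeff (f i) k)"
  by (induction I rule: finite_induct)
     (auto simp: fourier_coeff_add fourier_coeff_zero circle_integrable_sum)

text \<open>
  Unnormalized: the value at \<open>c * h / 2\<close> is the factor by which averaging over an interval of length
  \<open>h\<close> multiplies the exponential of frequency \<open>c\<close>.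
\<close>

definition sinc :: "real \<Rightarrow> real" where
  "sinc x = (if x = 0 then 1 else sin x / x)"

lemma sinc_minus [simp]: "sinc (- x) = sinc x"
  by (simp add: sinc_def)

lemma integral_cis:
  assumes "h > 0"
  shows "integral {x - h/2..x + h/2} (\<lambda>t. cis (c * t)) = h * sinc (c * h / 2) * cis (c * x)"
proof (cases "c = 0")
  case True
  then show ?thesis using assms by (simp add: sinc_def scaleR_conv_of_real)
next
  case False
  have d: "((\<lambda>t. cis (c * t) / (\<i> * c)) has_vector_derivative cis (c * t)) (at t within S)" for t S
    unfolding cis_conv_exp
    by (rule derivative_eq_intros has_vector_derivative_real_field | simp add: False mult_ac)+
  have I: "((\<lambda>t. cis (c * t)) has_integral (cis (c * (x + h/2)) / (\<i> * c) - cis (c * (x - h/2)) / (\<i> * c)))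
         {x - h/2..x + h/2}"
    by (rule fundamental_theorem_of_calculus) (use assms d in auto)
  have 1: "cis (c * (x + h/2)) / (\<i> * c) - cis (c * (x - h/2)) / (\<i> * c) =
     cis (c * x) * (cis (c * h / 2) - cis (- (c * h / 2))) / (\<i> * c)"
    by (simp add: algebra_simps cis_mult diff_divide_distrib)
  have 2: "cis (c * h / 2) - cis (- (c * h / 2)) = \<i> * (2 * sin (c * h / 2))"
    by (simp add: complex_eq_iff)
  have "cis (c * (x + h/2)) / (\<i> * c) - cis (c * (x - h/2)) / (\<i> * c) =
      h * sinc (c * h / 2) * cis (c * x)"
    unfolding 1 2 using False assms by (simp add: sinc_def)
  with I show ?thesis by (simp add: integral_unique)
qed

lemma steklov_cis:
  assumes "h > 0"
  shows "steklov h (\<lambda>t. cis (of_int k * t)) x = sinc (of_int k * h / 2) * cis (of_int k * x)"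
  using assms by (subst steklov_eq_integral) (auto simp: integral_cis)

lemma fourier_coeff_cis: "fourier_coeff (\<lambda>x. cis (of_int j * x)) k = (if j = k then 1 else 0)"
proof -
  have "integral {-pi..pi} (\<lambda>t. cis (of_int j * t) * cis (- (of_int k * t))) =
        integral {0 - 2*pi/2..0 + 2*pi/2} (\<lambda>t. cis (of_int (j - k) * t))"
    by (simp add: cis_mult algebra_simps)
  also have "\<dots> = complex_of_real (2 * pi) * sinc (of_int (j - k) * pi)"
    by (subst integral_cis) auto
  also have "sinc (of_int (j - k) * pi) = (if j = k then 1 else 0)"
    using sin_integer_2pi sin_npi_int[of "j-k"] by (auto simp: sinc_def mult.commute)
  finally show ?thesis by (auto simp: fourier_coeff_def)
qed

lemma steklov_periodic:
  assumes "circle_integrable f"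
  shows "steklov h f (x + 2 * pi) = steklov h f x"
proof -
  have "integral {x + 2*pi - h/2..x + 2*pi + h/2} f = integral {x - h/2..x + h/2} (\<lambda>t. f (t + 2*pi))"
    using integral_shift_Icc_real[of "x-h/2" "x+h/2" f "2*pi"] by (simp add: o_def algebra_simps)
  then show ?thesis
    using assms by (simp add: steklov_eq_integral circle_integrable_periodic)
qed

lemma continuous_steklov:
  assumes f: "circle_integrable f" and h: "h > 0"
  shows "continuous_on UNIV (steklov h f)"
proof -
  have "isCont (steklov h f) y" for y
  proof -
    define a where "a = y - h/2 - 1"
    define b where "b = y + h/2 + 1"
    define F where "F = (\<lambda>x. integral {a..x} f)"
    have F: "continuous_on {a..b} F"
      unfolding F_def using f by (intro indefinite_integral_continuous_1) auto
    have cF: "isCont F x" if "a < x" "x < b" for x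
      using F that by (metis continuous_on_interior interior_atLeastAtMost_real greaterThanLessThan_iff)
    have "isCont (\<lambda>x. complex_of_real (1/h) * (F (x + h/2) - F (x - h/2))) y"
      by (intro continuous_intros isCont_o2[of y "\<lambda>x. x + h/2" F] isCont_o2[of y "\<lambda>x. x - h/2" F] cF)
         (use h in \<open>auto simp: a_def b_def\<close>)
    moreover have "\<forall>\<^sub>F x in nhds y. complex_of_real (1/h) * (F (x + h/2) - F (x - h/2)) = steklov h f x"
    proof -
      have "\<forall>\<^sub>F x in nhds y. x \<in> {y-1<..<y+1}" by (intro eventually_nhds_in_open) auto
      then show ?thesis
      proof eventually_elim
        case (elim x)
        have "integral {a..x - h/2} f + integral {x - h/2..x + h/2} f = integral {a..x + h/2} f"
          using elim h f by (intro Henstock_Kurzweil_Integration.integral_combine) (auto simp: a_def)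
        then show ?case using f by (auto simp: steklov_eq_integral F_def simp flip: diff_divide_distrib)
             (metis add_diff_cancel_left')
      qed
    qed
    ultimately show ?thesis using isCont_cong by fast
  qed
  then show ?thesis by (simp add: continuous_at_imp_continuous_on)
qed

lemma circle_integrable_steklov [intro]:
  "circle_integrable f \<Longrightarrow> h > 0 \<Longrightarrow> circle_integrable (steklov h f)"
  by (rule circle_integrable_continuous) (simp_all add: continuous_steklov steklov_periodic)

lemma steklov_add:
  "circle_integrable f \<Longrightarrow> circle_integrable g \<Longrightarrow>
   steklov h (\<lambda>x. f x + g x) x = steklov h f x + steklov h g x"
  by (simp add: steklov_eq_integral circle_integrable_add Henstock_Kurzweil_Integration.integral_add distrib_left add_divide_distrib)

lemma steklov_diff:
  "circle_integrable f \<Longrightarrow> circle_integrable g \<Longrightarrow>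
   steklov h (\<lambda>x. f x - g x) x = steklov h f x - steklov h g x"
  by (simp add: steklov_eq_integral circle_integrable_diff Henstock_Kurzweil_Integration.integral_diff right_diff_distrib diff_divide_distrib)

lemma steklov_cmult:
  "circle_integrable f \<Longrightarrow> steklov h (\<lambda>x. c * f x) x = c * steklov h f x"
  by (simp add: steklov_eq_integral circle_integrable_mult_left)

lemma steklov_zero: "steklov h (\<lambda>x. 0) x = 0"
  by (simp add: steklov_def)

lemma steklov_sum:
  "finite I \<Longrightarrow> (\<And>i. i \<in> I \<Longrightarrow> circle_integrable (f i)) \<Longrightarrow>
   steklov h (\<lambda>x. \<Sum>i\<in>I. f i x) x = (\<Sum>i\<in>I. steklov h (f i) x)"
  by (induction I rule: finite_induct) (auto simp: steklov_add steklov_zero circle_integrable_sum)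

text \<open>
  By Fubini the average over the shift can be taken outside the integral over the circle, where a
  shift by \<open>s\<close> multiplies the \<open>k\<close>-th coefficient by \<open>cis (k * s)\<close>. Joint measurability of
  \<open>(x, s) \<mapsto> f (x + s)\<close> is available only for Borel functions, so \<open>f\<close> is replaced by a Borel
  function \<open>g\<close> that agrees with it almost everywhere; \<open>g\<close> is cut off to the interval \<open>J\<close> that
  the shifted arguments can reach, which makes it integrable on the line.
\<close>

lemma fourier_coeff_steklov:
  assumes f: "circle_integrable f" and h: "h > 0"
  shows "fourier_coeff (steklov h f) k = sinc (of_int k * h / 2) * fourier_coeff f k"
proof -
  define a where "a = h / 2"
  have a: "a > 0" "h = 2 * a" using h by (auto simp: a_def)
  define J where "J = {-pi - a..pi + a}"
  obtain g where gm[measurable]: "g \<in> borel_measurable borel" and ae: "AE x in lborel. f x = g x"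
  proof -
    have "(\<lambda>x. Re (f x)) \<in> borel_measurable (completion lborel)" "(\<lambda>x. Im (f x)) \<in> borel_measurable (completion lborel)"
      using measurable_compose[OF circle_integrable_measurable[OF f] borel_measurable_Re]
            measurable_compose[OF circle_integrable_measurable[OF f] borel_measurable_Im] by simp_all
    from this[THEN completion_ex_borel_measurable_real] obtain u v where
      "u \<in> borel_measurable lborel" "AE x in lborel. Re (f x) = u x"
      "v \<in> borel_measurable lborel" "AE x in lborel. Im (f x) = v x" by auto
    note uv = this
    show ?thesis
    proof (rule that)
      show "(\<lambda>x. complex_of_real (u x) + \<i> * v x) \<in> borel_measurable borel"
        using uv by simp
      show "AE x in lborel. f x = complex_of_real (u x) + \<i> * v x"
        using uv(2,4) by eventually_elim (simp add: complex_eq_iff)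
    qed
  qed
  define g0 where "g0 = (\<lambda>x. indicator J x *\<^sub>R g x)"
  have g0m[measurable]: "g0 \<in> borel_measurable borel"
    unfolding g0_def J_def by measurable
  have ae_leb: "AE x in lebesgue. f x = g x" using ae by (rule AE_completion)
  have localize: "(LINT t|lborel. indicator {c..d} t *\<^sub>R (g0 t * u t)) = integral {c..d} (\<lambda>t. f t * u t)"
    if "{c..d} \<subseteq> J" and u[measurable]: "u \<in> borel_measurable borel"
      and i: "(\<lambda>t. f t * u t) absolutely_integrable_on {c..d}" for c d u
  proof -
    have "(LINT t|lborel. indicator {c..d} t *\<^sub>R (g0 t * u t)) = (LINT t|lebesgue. indicator {c..d} t *\<^sub>R (g0 t * u t))"
      by (rule integral_completion[symmetric]) measurable
    also have "\<dots> = (LINT t:{c..d}|lebesgue. f t * u t)"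
      unfolding set_lebesgue_integral_def
    proof (rule integral_cong_AE)
      show "(\<lambda>t. indicat_real {c..d} t *\<^sub>R (g0 t * u t)) \<in> borel_measurable lebesgue"
        by (rule measurable_completion) measurable
      show "(\<lambda>t. indicat_real {c..d} t *\<^sub>R (f t * u t)) \<in> borel_measurable lebesgue"
        using i by (auto simp: set_integrable_def)
      show "AE t in lebesgue. indicat_real {c..d} t *\<^sub>R (g0 t * u t) = indicat_real {c..d} t *\<^sub>R (f t * u t)"
        using ae_leb by eventually_elim (use that(1) in \<open>auto simp: g0_def indicator_def\<close>)
    qed
    also have "\<dots> = integral {c..d} (\<lambda>t. f t * u t)"
      by (rule set_lebesgue_integral_eq_integral(2)[OF i])
    finally show ?thesis .
  qed
  have g0i: "integrable lborel g0"
  proof -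
    have "integrable lebesgue (\<lambda>x. indicator J x *\<^sub>R f x)"
      using circle_integrable_on[OF f] unfolding J_def set_integrable_def by blast
    moreover have "AE x in lebesgue. indicator J x *\<^sub>R f x = g0 x"
      using ae_leb by eventually_elim (simp add: g0_def)
    ultimately have "integrable lebesgue g0"
      by (subst integrable_cong_AE[symmetric]) (auto intro: measurable_completion)
    then show ?thesis by (simp add: integrable_completion)
  qed
  define H where "H = (\<lambda>x s. indicator {-pi..pi} x *\<^sub>R indicator {-a..a} s *\<^sub>R (g0 (x + s) * cis (- (of_int k * x))))"
  have cism[measurable]: "(\<lambda>x. cis (c * x)) \<in> borel_measurable borel" 
      "(\<lambda>x. cis (- (c * x))) \<in> borel_measurable borel" for c :: real
    by (intro borel_measurable_continuous_onI continuous_intros)+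
  have Hm: "case_prod H \<in> borel_measurable (lborel \<Otimes>\<^sub>M lborel)"
    unfolding H_def by measurable
  have shifti: "integrable lborel (\<lambda>s. g0 (x + s))" for x
    using lborel_integrable_real_affine[OF g0i, of 1 x] by simp
  have Hint: "integrable (lborel \<Otimes>\<^sub>M lborel) (case_prod H)"
  proof (rule lborel_pair.Fubini_integrable[OF Hm])
    let ?B = "LINT t|lborel. norm (g0 t)"
    have bd: "norm (H x s) \<le> indicator {-pi..pi} x * norm (g0 (x + s))" for x s
      by (auto simp: H_def norm_mult indicator_def)
    have i1: "integrable lborel (H x)" for x
      by (rule Bochner_Integration.integrable_bound[OF shifti[of x]])
         (auto simp: H_def norm_mult indicator_def intro!: AE_I2)
    then show "AE x in lborel. integrable lborel (\<lambda>s. case_prod H (x, s))" by simp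
    have m: "(\<lambda>x. LINT s|lborel. norm (H x s)) \<in> borel_measurable lborel"
      using Hm by measurable
    show "integrable lborel (\<lambda>x. LINT s|lborel. norm (case_prod H (x, s)))"
    proof (rule Bochner_Integration.integrable_bound)
      show "integrable lborel (\<lambda>x. indicator {-pi..pi} x *\<^sub>R ?B)"
        by (intro integrable_real_indicator integrable_scaleR_left) auto
      show "AE x in lborel. norm (LINT s|lborel. norm (case_prod H (x, s))) \<le> norm (indicator {-pi..pi} x *\<^sub>R ?B)"
      proof (rule AE_I2)
        fix x
        have "(LINT s|lborel. norm (H x s)) \<le> (LINT s|lborel. indicator {-pi..pi} x * norm (g0 (x + s)))"
          by (rule integral_mono) (use i1 shifti bd in auto)
        also have "\<dots> = indicator {-pi..pi} x * ?B"
          using lborel_integral_real_affine[of 1 "\<lambda>t. norm (g0 t)" x] by simp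
        finally show "norm (LINT s|lborel. norm (case_prod H (x, s))) \<le> norm (indicator {-pi..pi} x *\<^sub>R ?B)"
          by (simp add: integral_nonneg_AE)
      qed
    qed (use m in simp)
  qed
  have inner_s: "(LINT s|lborel. H x s) =
      indicator {-pi..pi} x *\<^sub>R (h * steklov h f x * cis (- (of_int k * x)))" for x
  proof (cases "x \<in> {-pi..pi}")
    case True
    have "(LINT s|lborel. H x s) = (LINT s|lborel. indicator {-a..a} s *\<^sub>R g0 (x + s)) * cis (- (of_int k * x))"
      using True by (simp add: H_def flip: mult_scaleR_left)
    also have "(LINT s|lborel. indicator {-a..a} s *\<^sub>R g0 (x + s)) =
               (LINT t|lborel. indicator {x - a..x + a} t *\<^sub>R (g0 t * 1))"
      by (subst (2) lborel_integral_real_affine[where c = 1 and t = x])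
         (auto intro!: Bochner_Integration.integral_cong simp: indicator_def)
    also have "\<dots> = integral {x - a..x + a} (\<lambda>t. f t * 1)"
      by (rule localize) (use True f in \<open>auto simp: J_def\<close>)
    also have "\<dots> = h * steklov h f x"
      using f h by (simp add: steklov_eq_integral a_def)
    finally show ?thesis using True by simp
  qed (simp add: H_def)
  have inner_x: "(LINT x|lborel. H x s) =
      indicator {-a..a} s *\<^sub>R (2 * pi * fourier_coeff f k * cis (of_int k * s))" for s
  proof (cases "s \<in> {-a..a}")
    case True
    have "(LINT x|lborel. H x s) = (LINT x|lborel. indicator {-pi..pi} x *\<^sub>R (g0 (x + s) * cis (- (of_int k * x))))"
      using True by (simp add: H_def)
    also have "\<dots> = (LINT t|lborel. indicator {-pi + s..pi + s} t *\<^sub>R (g0 t * cis (- (of_int k * t))) * cis (of_int k * s))"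
      by (subst (2) lborel_integral_real_affine[where c = 1 and t = s])
         (auto intro!: Bochner_Integration.integral_cong simp: indicator_def cis_mult algebra_simps)
    also have "\<dots> = (LINT t|lborel. indicator {-pi + s..pi + s} t *\<^sub>R (g0 t * cis (- (of_int k * t)))) * cis (of_int k * s)"
      by (simp only: integral_mult_left_zero)
    also have "(LINT t|lborel. indicator {-pi + s..pi + s} t *\<^sub>R (g0 t * cis (- (of_int k * t)))) =
        integral {-pi + s..pi + s} (\<lambda>t. f t * cis (- (of_int k * t)))"
      by (rule localize) (use True in \<open>auto simp: J_def intro!: circle_integrable_on circle_integrable_mult_cis' f\<close>)
    also have "\<dots> = 2 * pi * fourier_coeff f k"
      using integral_period[OF circle_integrable_mult_cis'[OF f], of "s - pi" k]
      by (simp add: fourier_coeff_def algebra_simps)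
    finally show ?thesis using True by simp
  qed (simp add: H_def)
  have st: "circle_integrable (steklov h f)" using f h by blast
  have "h * (2 * pi * fourier_coeff (steklov h f) k) = integral {-pi..pi} (\<lambda>x. h * (steklov h f x * cis (- (of_int k * x))))"
    by (simp add: fourier_coeff_def)
  also have "\<dots> = (LINT x|lebesgue. indicator {-pi..pi} x *\<^sub>R (h * (steklov h f x * cis (- (of_int k * x)))))"
    by (subst set_lebesgue_integral_eq_integral(2)[symmetric])
       (auto intro!: circle_integrable_on circle_integrable_mult_cis' circle_integrable_mult_left st
             simp: set_lebesgue_integral_def simp flip: mult_scaleR_right)
  also have "\<dots> = (LINT x|lborel. indicator {-pi..pi} x *\<^sub>R (h * (steklov h f x * cis (- (of_int k * x)))))"
  proof (rule integral_completion)
    have [measurable]: "steklov h f \<in> borel_measurable borel"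
      by (rule borel_measurable_continuous_onI[OF continuous_steklov[OF f h]])
    show "(\<lambda>x. indicator {-pi..pi} x *\<^sub>R (h * (steklov h f x * cis (- (of_int k * x))))) \<in> borel_measurable lborel"
      by measurable
  qed
  also have "\<dots> = (LINT x|lborel. LINT s|lborel. H x s)"
    by (simp add: inner_s mult.assoc)
  also have "\<dots> = (LINT s|lborel. LINT x|lborel. H x s)"
    by (rule lborel_pair.Fubini_integral[OF Hint, symmetric])
  also have "\<dots> = (LINT s|lborel. indicator {-a..a} s *\<^sub>R (cis (of_int k * s) * (2 * pi * fourier_coeff f k)))"
    by (simp add: inner_x mult.commute)
  also have "\<dots> = (LINT s|lborel. indicator {-a..a} s *\<^sub>R cis (of_int k * s)) * (2 * pi * fourier_coeff f k)"
    by (simp flip: mult_scaleR_left)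
  also have "(LINT s|lborel. indicator {-a..a} s *\<^sub>R cis (of_int k * s)) = (LINT s:{-a..a}|lebesgue. cis (of_int k * s))"
    unfolding set_lebesgue_integral_def by (rule integral_completion[symmetric]) measurable
  also have "\<dots> = integral {-a..a} (\<lambda>s. cis (of_int k * s))"
    by (rule set_lebesgue_integral_eq_integral(2)) auto
  also have "\<dots> = h * sinc (of_int k * h / 2)"
    using integral_cis[OF h, of 0 "of_int k"] by (simp add: a_def)
  finally show ?thesis using h by simp
qed

section \<open>Partial sums, multipliers and interpolation\<close>

definition fourier_sum :: "nat \<Rightarrow> (real \<Rightarrow> complex) \<Rightarrow> real \<Rightarrow> complex" where
  "fourier_sum n f x = (\<Sum>k = - int n..int n. fourier_coeff f k * cis (of_int k * x))"

text \<open>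
  The multiplier depends on the frequency only through its absolute value; this symmetry is what
  allows summation by parts over symmetric partial sums.
\<close>

definition fourier_multiplier :: "(nat \<Rightarrow> real) \<Rightarrow> nat \<Rightarrow> (real \<Rightarrow> complex) \<Rightarrow> real \<Rightarrow> complex" where
  "fourier_multiplier a n f x =
     (\<Sum>k = - int n..int n. a (nat \<bar>k\<bar>) * fourier_coeff f k * cis (of_int k * x))"

lemma dirichlet_kernel_cis: "dirichlet_kernel n x = (\<Sum>k = - int n..int n. cis (of_int k * x))"
  by (simp add: dirichlet_kernel_def cis_conv_exp mult.assoc)

lemma circle_integrable_trig_sum [simp]: 
  "circle_integrable (\<lambda>x. \<Sum>k\<in>S. c k * cis (of_int k * x))"
  by (intro circle_integrable_sum circle_integrable_mult_left circle_integrable_cis)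

lemma circle_integrable_fourier_sum [simp]: "circle_integrable (fourier_sum n f)"
  unfolding fourier_sum_def by simp

lemma fourier_coeff_trig_sum:
  "finite S \<Longrightarrow> fourier_coeff (\<lambda>x. \<Sum>k\<in>S. c k * cis (of_int k * x)) j = (if j \<in> S then c j else 0)"
  by (subst fourier_coeff_sum) 
     (auto simp: fourier_coeff_cmult fourier_coeff_cis circle_integrable_mult_left if_distrib
           intro!: sum.neutral cong: if_cong)

lemma steklov_trig_sum:
  assumes "h > 0" "finite S"
  shows "steklov h (\<lambda>x. \<Sum>k\<in>S. c k * cis (of_int k * x)) x =
    (\<Sum>k\<in>S. c k * sinc (of_int k * h / 2) * cis (of_int k * x))"
  using assms by (subst steklov_sum)
    (auto simp: steklov_cmult steklov_cis circle_integrable_mult_left mult.assoc)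

lemma convolution_dirichlet_kernel:
  assumes f: "circle_integrable f"
  shows "convolution f (dirichlet_kernel n) = fourier_sum n f"
proof
  fix x
  let ?g = "\<lambda>k t. cis (of_int k * x) * (f t * cis (- (of_int k * t)))"
  have eq: "f t * dirichlet_kernel n (x - t) = (\<Sum>k = - int n..int n. ?g k t)" for t
    unfolding dirichlet_kernel_cis sum_distrib_left
    by (intro sum.cong) (simp_all add: cis_mult algebra_simps)
  have ci: "circle_integrable (?g k)" for k
    by (intro circle_integrable_mult_left circle_integrable_mult_cis' f)
  have "circle_integrable (\<lambda>t. \<Sum>k = - int n..int n. ?g k t)"
    by (intro circle_integrable_sum ci)
  then have "convolution f (dirichlet_kernel n) x = integral {-pi..pi} (\<lambda>t. \<Sum>k = - int n..int n. ?g k t) / (2 * pi)"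
    unfolding convolution_def eq by (intro integral_circle_measure) auto
  also have "\<dots> = (\<Sum>k = - int n..int n. integral {-pi..pi} (?g k)) / (2 * pi)"
    by (subst Henstock_Kurzweil_Integration.integral_sum[OF _ circle_integrable_on'[OF ci]]) simp_all
  also have "\<dots> = fourier_sum n f x"
    by (simp add: fourier_sum_def fourier_coeff_def sum_divide_distrib mult.commute)
  finally show "convolution f (dirichlet_kernel n) x = fourier_sum n f x" .
qed

lemma sum_symmetric_Suc:
  fixes g :: "int \<Rightarrow> complex"
  shows "(\<Sum>k = - int (Suc M)..int (Suc M). g k) = (\<Sum>k = - int M..int M. g k) + (g (int (Suc M)) + g (- int (Suc M)))"
proof -
  have "{- int (Suc M)..int (Suc M)} = insert (int (Suc M)) (insert (- int (Suc M)) {- int M..int M})"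
    by auto
  then show ?thesis by simp
qed

text \<open>
  Abel summation. It expresses the multiplier through partial sums only, so that bounds on the
  partial sums turn into bounds by the variation and the last value of \<open>a\<close>.
\<close>

lemma fourier_multiplier_by_parts:
  "fourier_multiplier a M f x =
     (\<Sum>j<M. complex_of_real (a j - a (Suc j)) * fourier_sum j f x) + a M * fourier_sum M f x"
proof (induction M)
  case 0
  then show ?case by (simp add: fourier_multiplier_def fourier_sum_def)
next
  case (Suc M)
  define t where "t = (\<lambda>k. fourier_coeff f k * cis (of_int k * x))"
  have m: "fourier_multiplier a M f x = (\<Sum>k = - int M..int M. a (nat \<bar>k\<bar>) * t k)" for M
    by (simp add: fourier_multiplier_def t_def mult.assoc)
  have s: "fourier_sum M f x = (\<Sum>k = - int M..int M. t k)" for M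
    by (simp add: fourier_sum_def t_def)
  have 1: "fourier_sum (Suc M) f x = fourier_sum M f x + (t (int (Suc M)) + t (- int (Suc M)))"
    unfolding s by (rule sum_symmetric_Suc)
  have n: "nat \<bar>int (Suc M)\<bar> = Suc M" "nat \<bar>- int (Suc M)\<bar> = Suc M" by linarith+
  have "fourier_multiplier a (Suc M) f x = fourier_multiplier a M f x
      + (a (Suc M) * t (int (Suc M)) + a (Suc M) * t (- int (Suc M)))"
    unfolding m sum_symmetric_Suc n ..
  then show ?case unfolding Suc.IH 1 by (simp add: algebra_simps)
qed

lemma sampling_operator_trig_sum:
  "sampling_operator \<gamma> n f x = (\<Sum>j = - int n..int n.
     (1 / of_nat (2 * n + 1) * (\<Sum>k = 0..2 * n. steklov (\<gamma> / real n) f (node n k) * cis (- (of_int j * node n k))))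
       * cis (of_int j * x))"
proof -
  have cis_diff: "cis (of_int j * (x - t)) = cis (- (of_int j * t)) * cis (of_int j * x)" for j t
    by (simp add: cis_mult right_diff_distrib)
  have "sampling_operator \<gamma> n f x = 1 / of_nat (2 * n + 1) *
     (\<Sum>k = 0..2 * n. \<Sum>j = - int n..int n. steklov (\<gamma> / real n) f (node n k) * cis (- (of_int j * node n k)) * cis (of_int j * x))"
    unfolding sampling_operator_def dirichlet_kernel_cis sum_distrib_left
    by (simp add: mult.assoc cis_diff)
  also have "\<dots> = 1 / of_nat (2 * n + 1) *
     (\<Sum>j = - int n..int n. \<Sum>k = 0..2 * n. steklov (\<gamma> / real n) f (node n k) * cis (- (of_int j * node n k)) * cis (of_int j * x))"
    by (subst sum.swap) simp
  also have "\<dots> = (\<Sum>j = - int n..int n.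
     (1 / of_nat (2 * n + 1) * (\<Sum>k = 0..2 * n. steklov (\<gamma> / real n) f (node n k) * cis (- (of_int j * node n k))))
       * cis (of_int j * x))"
    by (simp add: sum_distrib_left sum_distrib_right mult.assoc)
  finally show ?thesis .
qed

lemma circle_integrable_sampling_operator [simp]: "circle_integrable (sampling_operator \<gamma> n f)"
  unfolding sampling_operator_trig_sum[abs_def] by (rule circle_integrable_trig_sum)

text \<open>
  For \<open>m \<noteq> 0\<close> this is a full sum over the powers of a root of unity of order dividing \<open>2 * n + 1\<close>,
  which differs from 1 because \<open>\<bar>m\<bar> < 2 * n + 1\<close>.
\<close>

lemma sum_cis_nodes:
  assumes "\<bar>m\<bar> \<le> 2 * int n"
  shows "(\<Sum>k = 0..2 * n. cis (of_int m * node n k)) = (if m = 0 then of_nat (2 * n + 1) else 0)"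
proof (cases "m = 0")
  case False
  define w where "w = cis (of_int m * 2 * pi / (2 * n + 1))"
  have "cis (of_int m * node n k) = w ^ k" for k
  proof -
    have "w ^ k = cis (real k * (of_int m * 2 * pi / (2 * n + 1)))"
      unfolding w_def by (rule Complex.DeMoivre)
    also have "real k * (of_int m * 2 * pi / (2 * n + 1)) = of_int m * node n k"
      by (simp add: node_def mult_ac)
    finally show ?thesis by simp
  qed
  then have "(\<Sum>k = 0..2 * n. cis (of_int m * node n k)) = (\<Sum>k<2 * n + 1. w ^ k)"
    by (intro sum.cong) auto
  moreover have "w ^ (2 * n + 1) = 1"
  proof -
    have "w ^ (2 * n + 1) = cis (2 * pi * of_int m)"
      unfolding w_def Complex.DeMoivre by (rule arg_cong[where f = cis]) (simp add: field_simps)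
    then show ?thesis by (simp add: cis_multiple_2pi)
  qed
  moreover have "w \<noteq> 1"
  proof
    assume "w = 1"
    then have "cos (of_int m * 2 * pi / (2 * n + 1)) = 1" by (simp add: w_def complex_eq_iff)
    then obtain q :: int where "of_int m * 2 * pi / (2 * n + 1) = of_int q * 2 * pi"
      by (metis cos_one_2pi_int)
    then have "of_int m * 2 * pi = of_int q * 2 * pi * (2 * n + 1)"
      by (subst (asm) nonzero_divide_eq_eq) auto
    then have "(2 * pi) * real_of_int m = (2 * pi) * of_int (q * (2 * int n + 1))"
      by (simp add: mult_ac)
    then have "real_of_int m = of_int (q * (2 * int n + 1))"
      by (subst (asm) mult_cancel_left) auto
    then have "m = q * (2 * int n + 1)" by (simp only: of_int_eq_iff)
    with False have "\<bar>m\<bar> = \<bar>q\<bar> * (2 * int n + 1)" "\<bar>q\<bar> \<ge> 1" by (auto simp: abs_mult)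
    then have "\<bar>m\<bar> \<ge> 2 * int n + 1"
      using mult_right_mono[of 1 "\<bar>q\<bar>" "2 * int n + 1"] by simp
    with assms show False by simp
  qed
  ultimately show ?thesis
    using False geometric_sum[of w "2 * n + 1"] by (simp only: diff_self div_0 if_False simp_thms)
qed simp

text \<open>
  Interpolation at \<open>2 * n + 1\<close> equidistant nodes reproduces polynomials of degree at most \<open>n\<close>; what
  is interpolated here is the Steklov average, which is again such a polynomial.
\<close>

lemma sampling_operator_of_trig_poly:
  assumes h: "\<gamma> / real n > 0"
  shows "sampling_operator \<gamma> n (\<lambda>x. \<Sum>k = - int n..int n. c k * cis (of_int k * x)) x =
         steklov (\<gamma> / real n) (\<lambda>x. \<Sum>k = - int n..int n. c k * cis (of_int k * x)) x"
proof -
  define s where "s = (\<lambda>k::int. complex_of_real (sinc (of_int k * (\<gamma> / real n) / 2)))"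
  let ?I = "{- int n..int n}"
  have st: "steklov (\<gamma> / real n) (\<lambda>x. \<Sum>k\<in>?I. c k * cis (of_int k * x)) y =
     (\<Sum>k\<in>?I. c k * s k * cis (of_int k * y))" for y
    unfolding s_def by (rule steklov_trig_sum) (use h in auto)
  have coef: "(\<Sum>k = 0..2 * n. (\<Sum>i\<in>?I. c i * s i * cis (of_int i * node n k)) * cis (- (of_int j * node n k)))
      = of_nat (2 * n + 1) * (c j * s j)" if "j \<in> ?I" for j
  proof -
    have "(\<Sum>k = 0..2 * n. (\<Sum>i\<in>?I. c i * s i * cis (of_int i * node n k)) * cis (- (of_int j * node n k)))
       = (\<Sum>i\<in>?I. c i * s i * (\<Sum>k = 0..2 * n. cis (of_int (i - j) * node n k)))"
      unfolding sum_distrib_left sum_distrib_right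
      by (subst sum.swap) (simp add: mult.assoc cis_mult algebra_simps)
    also have "\<dots> = (\<Sum>i\<in>?I. if i = j then of_nat (2 * n + 1) * (c j * s j) else 0)"
      using that by (intro sum.cong refl) (subst sum_cis_nodes, auto)
    finally show ?thesis using that by simp
  qed
  have nz: "complex_of_nat (2 * n + 1) \<noteq> 0"
    by (metis Suc_eq_plus1 nat.distinct(1) of_nat_eq_0_iff)
  show ?thesis
    unfolding sampling_operator_trig_sum st
    by (intro sum.cong refl) (subst coef, use nz in \<open>auto simp: divide_simps\<close>)
qed

lemma sampling_operator_diff:
  "circle_integrable f \<Longrightarrow> circle_integrable g \<Longrightarrow>
   sampling_operator \<gamma> n (\<lambda>x. f x - g x) x = sampling_operator \<gamma> n f x - sampling_operator \<gamma> n g x"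
  unfolding sampling_operator_def
  by (simp add: steklov_diff sum_subtractf algebra_simps)

section \<open>Variation of the multipliers\<close>

lemma sinc_0 [simp]: "sinc 0 = 1"
  by (simp add: sinc_def)

text \<open>
  This is the sign of the numerator in the derivative of \<open>sin x / x\<close>.
\<close>

lemma mult_cos_le_sin:
  assumes "0 \<le> x" "x \<le> pi"
  shows "x * cos x \<le> sin x"
proof -
  have "(\<lambda>t. sin t - t * cos t) 0 \<le> (\<lambda>t. sin t - t * cos t) x"
  proof (rule DERIV_nonneg_imp_nondecreasing[OF assms(1)])
    fix t assume t: "0 \<le> t" "t \<le> x"
    have "((\<lambda>t. sin t - t * cos t) has_real_derivative t * sin t) (at t)"
      by (auto intro!: derivative_eq_intros)
    moreover have "0 \<le> t * sin t"
      using t assms by (intro mult_nonneg_nonneg sin_ge_zero) auto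
    ultimately show "\<exists>y. ((\<lambda>t. sin t - t * cos t) has_real_derivative y) (at t) \<and> 0 \<le> y" by blast
  qed
  then show ?thesis by simp
qed

lemma sinc_antimono:
  assumes "0 \<le> x" "x \<le> y" "y \<le> pi"
  shows "sinc y \<le> sinc x"
proof (cases "x = 0")
  case True
  then show ?thesis using assms sin_x_le_x[of y] by (auto simp: sinc_def)
next
  case False
  have "sin y / y \<le> sin x / x"
  proof (rule DERIV_nonpos_imp_nonincreasing[OF assms(2)])
    fix t assume t: "x \<le> t" "t \<le> y"
    then have t0: "t > 0" using False assms by simp
    have "((\<lambda>t. sin t / t) has_real_derivative (t * cos t - sin t) / t\<^sup>2) (at t)"
      using t0 by (auto intro!: derivative_eq_intros simp: power2_eq_square mult.commute)
    moreover have "(t * cos t - sin t) / t\<^sup>2 \<le> 0"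
      using mult_cos_le_sin[of t] t t0 assms by (intro divide_nonpos_nonneg) auto
    ultimately show "\<exists>z. ((\<lambda>t. sin t / t) has_real_derivative z) (at t) \<and> z \<le> 0" by blast
  qed
  then show ?thesis using False assms by (simp add: sinc_def)
qed

lemma sinc_pos: "0 \<le> x \<Longrightarrow> x < pi \<Longrightarrow> 0 < sinc x"
  by (auto simp: sinc_def intro!: divide_pos_pos sin_gt_zero)

lemma abs_sinc_le_inverse: "0 < x \<Longrightarrow> \<bar>sinc x\<bar> \<le> 1 / x"
  by (simp add: sinc_def abs_divide divide_right_mono)

lemma abs_sinc_le_1: "0 \<le> x \<Longrightarrow> \<bar>sinc x\<bar> \<le> 1"
  using abs_sin_x_le_abs_x[of x] by (auto simp: sinc_def abs_divide divide_simps)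

lemma sinc_less_1:
  assumes "0 < x"
  shows "sinc x < 1"
proof (cases "x \<le> pi")
  case True
  have "sin x = 2 * sin (x/2) * cos (x/2)" using sin_double[of "x/2"] by simp
  also have "\<dots> < 2 * sin (x/2)"
  proof -
    have "sin (x/2) > 0" using True assms by (intro sin_gt_zero) auto
    moreover have "cos (x/2) < 1" using cos_monotone_0_pi[of 0 "x/2"] True assms by simp
    ultimately show ?thesis by simp
  qed
  also have "\<dots> \<le> x" using sin_x_le_x[of "x/2"] assms by simp
  finally show ?thesis using assms by (simp add: sinc_def)
next
  case False
  then have "1 / x < 1" using pi_gt3 by simp
  then show ?thesis using abs_sinc_le_inverse[OF assms] by linarith
qed

text \<open>
  On \<open>{b..pi}\<close> monotonicity gives the bound \<open>sinc b\<close>, beyond \<open>pi\<close> the decay gives \<open>1 / 3\<close>.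
\<close>

lemma sinc_away_from_1:
  assumes "0 < b"
  obtains d where "0 < d" "\<And>x. b \<le> x \<Longrightarrow> sinc x \<le> 1 - d"
proof
  show "0 < min (1 - sinc b) (1/3)" using sinc_less_1[OF assms] by simp
  fix x assume x: "b \<le> x"
  show "sinc x \<le> 1 - min (1 - sinc b) (1/3)"
  proof (cases "x \<le> pi")
    case True
    then show ?thesis using sinc_antimono[of b x] x assms by simp
  next
    case False
    then have "1 / x \<le> 1 / 3" using pi_gt3 by (intro divide_left_mono) auto
    then show ?thesis using abs_sinc_le_inverse[of x] x assms by linarith
  qed
qed

lemma sinc_diff_le:
  assumes "0 < x" "x \<le> y"
  shows "\<bar>sinc x - sinc y\<bar> \<le> 2 * (y - x) / x"
proof -
  have "\<bar>sin x - sin y\<bar> = 2 * \<bar>sin ((x - y) / 2)\<bar> * \<bar>cos ((x + y) / 2)\<bar>"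
    by (simp add: sin_diff_sin abs_mult)
  also have "\<dots> \<le> 2 * \<bar>(x - y) / 2\<bar> * 1"
    by (intro mult_mono abs_sin_x_le_abs_x mult_nonneg_nonneg) auto
  finally have 1: "\<bar>sin x - sin y\<bar> \<le> y - x" using assms by simp
  have "sinc x - sinc y = (sin x - sin y) / x + sinc y * (y - x) / x"
    using assms by (simp add: sinc_def field_simps)
  also have "\<bar>\<dots>\<bar> \<le> \<bar>sin x - sin y\<bar> / x + \<bar>sinc y\<bar> * (y - x) / x"
    using assms by (intro abs_triangle_ineq[THEN order_trans]) (simp add: abs_divide abs_mult)
  also have "\<dots> \<le> (y - x) / x + 1 * (y - x) / x"
    using assms by (intro add_mono divide_right_mono mult_right_mono 1 abs_sinc_le_1) auto
  finally show ?thesis by simp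
qed

lemma square_over_one_minus_diff_le:
  fixes s t r d :: real
  assumes "\<bar>s\<bar> \<le> r" "\<bar>t\<bar> \<le> r" "\<bar>s\<bar> \<le> 1" "s \<le> 1 - d" "t \<le> 1 - d" "0 < d"
  shows "\<bar>s\<^sup>2 / (1 - s) - t\<^sup>2 / (1 - t)\<bar> \<le> \<bar>s - t\<bar> * (3 * r) / d\<^sup>2"
proof -
  have "s\<^sup>2 / (1 - s) - t\<^sup>2 / (1 - t) = (s - t) * (s + t - s * t) / ((1 - s) * (1 - t))"
    using assms by (simp add: field_simps power2_eq_square)
  also have "\<bar>\<dots>\<bar> = \<bar>s - t\<bar> * \<bar>s + t - s * t\<bar> / ((1 - s) * (1 - t))"
    using assms by (simp add: abs_divide abs_mult)
  also have "\<dots> \<le> \<bar>s - t\<bar> * (3 * r) / d\<^sup>2"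
  proof (rule frac_le)
    have "\<bar>s * t\<bar> \<le> 1 * r" unfolding abs_mult using assms by (intro mult_mono) auto
    then have "\<bar>s + t - s * t\<bar> \<le> 3 * r" using assms by linarith
    then show "\<bar>s - t\<bar> * \<bar>s + t - s * t\<bar> \<le> \<bar>s - t\<bar> * (3 * r)" by (intro mult_left_mono) auto
    show "d\<^sup>2 \<le> (1 - s) * (1 - t)" unfolding power2_eq_square using assms by (intro mult_mono) auto
  qed (use assms in auto)
  finally show ?thesis .
qed

text \<open>
  The sequence increases from 1, so its variation telescopes.
\<close>

lemma inverse_sinc_variation:
  assumes e: "0 \<le> e" and n: "real n * e < pi"
  defines "a \<equiv> \<lambda>j. 1 / sinc (real j * e)"
  shows "(\<Sum>j<n. \<bar>a j - a (Suc j)\<bar>) + \<bar>a n\<bar> \<le> 2 / sinc (real n * e)"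
proof -
  have r: "0 \<le> real j * e" "real j * e < pi" if "j \<le> n" for j
    using that e n mult_right_mono[of "real j" "real n" e] by auto
  have "\<bar>a j - a (Suc j)\<bar> = a (Suc j) - a j" if "j < n" for j
  proof -
    have "a j \<le> a (Suc j)"
      unfolding a_def
    proof (rule divide_left_mono)
      show "sinc (real (Suc j) * e) \<le> sinc (real j * e)"
        using r[of j] r[of "Suc j"] that e by (intro sinc_antimono) (auto simp: distrib_right)
      show "0 < sinc (real j * e) * sinc (real (Suc j) * e)" 
        using r[of j] r[of "Suc j"] that by (intro mult_pos_pos sinc_pos) auto
    qed auto
    then show ?thesis by simp
  qed
  then have "(\<Sum>j<n. \<bar>a j - a (Suc j)\<bar>) = (\<Sum>j<n. a (Suc j) - a j)" by simp
  also have "\<dots> = a n - 1" by (subst sum_lessThan_telescope) (simp add: a_def)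
  moreover have "a n > 0" unfolding a_def using r[of n] by (intro divide_pos_pos sinc_pos) auto
  ultimately show ?thesis by (simp add: a_def)
qed

text \<open>
  With step \<open>b / n\<close> the arguments start at \<open>b\<close>, where \<open>1 - sinc\<close> is bounded below. At index
  \<open>j \<ge> n\<close> the increment of \<open>sinc\<close> is at most \<open>2 / j\<close> and \<open>sinc\<close> itself is at most \<open>n / (b * j)\<close>, so the
  increment of \<open>sinc\<^sup>2 / (1 - sinc)\<close> is of order \<open>n / j\<^sup>2\<close>, and these sum to a bound independent of
  \<open>n\<close>. Freezing the sequence below \<open>n\<close> by \<open>max j n\<close> avoids variation at low frequencies, where the
  multiplier will be applied to vanishing coefficients.
\<close>

lemma sinc_tail_variation:
  assumes b: "0 < b"
  obtains C where "0 < C"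
    "\<And>n M a. 0 < n \<Longrightarrow>
       a = (\<lambda>j. (sinc (real (max j n) * (b / real n)))\<^sup>2 / (1 - sinc (real (max j n) * (b / real n)))) \<Longrightarrow>
       (\<Sum>j<M. \<bar>a j - a (Suc j)\<bar>) + \<bar>a M\<bar> \<le> C"
proof -
  obtain d where d: "0 < d" "\<And>x. b \<le> x \<Longrightarrow> sinc x \<le> 1 - d" using sinc_away_from_1[OF b] by blast
  define K where "K = 12 / (b * d\<^sup>2)"
  have K: "K > 0" using b d by (simp add: K_def)
  show ?thesis
  proof (rule that[of "K + 1 / d"])
    show "0 < K + 1 / d" using K d by (simp add: add_pos_pos)
    fix n M :: nat and a
    assume n: "0 < n" and
      a: "a = (\<lambda>j. (sinc (real (max j n) * (b / real n)))\<^sup>2 / (1 - sinc (real (max j n) * (b / real n))))"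
    define x where "x = (\<lambda>j. real j * (b / real n))"
    have xs: "real j * (b / real n) = x j" for j by (simp add: x_def)
    have xb: "x j \<ge> b" if "j \<ge> n" for j
      using that n b mult_right_mono[of "real n" "real j" "b / real n"] by (simp add: x_def)
    have step: "\<bar>a j - a (Suc j)\<bar> \<le> K * n * (1 / real (max j n) - 1 / real (max (Suc j) n))" for j
    proof (cases "j < n")
      case True
      then have "max j n = n" "max (Suc j) n = n" by auto
      then show ?thesis by (simp add: a)
    next
      case False
      then have j: "j \<ge> n" and mx: "max j n = j" "max (Suc j) n = Suc j" by auto
      have j1: "real j \<ge> 1" using j n by simp
      have pos: "x j > 0" using xb[OF j] b by simp
      have le: "x j \<le> x (Suc j)" using b n by (simp add: x_def divide_simps)
      have "\<bar>a j - a (Suc j)\<bar> \<le> \<bar>sinc (x j) - sinc (x (Suc j))\<bar> * (3 * (1 / x j)) / d\<^sup>2"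
        unfolding a mx xs
      proof (rule square_over_one_minus_diff_le)
        have "\<bar>sinc (x (Suc j))\<bar> \<le> 1 / x (Suc j)" using pos le by (intro abs_sinc_le_inverse) auto
        also have "\<dots> \<le> 1 / x j" using pos le by (intro divide_left_mono mult_pos_pos) auto
        finally show "\<bar>sinc (x (Suc j))\<bar> \<le> 1 / x j" .
      qed (use pos le d xb j in \<open>auto intro: abs_sinc_le_inverse abs_sinc_le_1\<close>)
      also have "\<dots> \<le> (2 * (x (Suc j) - x j) / x j) * (3 * (1 / x j)) / d\<^sup>2"
        using pos le by (intro divide_right_mono mult_right_mono sinc_diff_le) auto
      also have "\<dots> = K * n * (1 / (2 * real j * real j))"
        using n b d j1 by (simp add: K_def x_def field_simps)
      \<comment> \<open>From \<open>1 / j\<^sup>2\<close> to a telescoping term, at the cost of the factor 2 built into \<open>K\<close>.\<close>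
      also have "\<dots> \<le> K * n * (1 / (real j * (real j + 1)))"
      proof (intro mult_left_mono divide_left_mono)
        show "real j * (real j + 1) \<le> 2 * real j * real j"
          using j1 mult_left_mono[of "real j + 1" "2 * real j" "real j"] by (simp add: mult_ac)
        show "0 < 2 * real j * real j * (real j * (real j + 1))"
          using j1 by (intro mult_pos_pos) auto
      qed (use K in auto)
      also have "1 / (real j * (real j + 1)) = 1 / real j - 1 / real (Suc j)"
        using j1 by (simp add: field_simps)
      finally show ?thesis unfolding mx .
    qed
    have "(\<Sum>j<M. \<bar>a j - a (Suc j)\<bar>) \<le> (\<Sum>j<M. K * n * (1 / real (max j n) - 1 / real (max (Suc j) n)))"
      by (intro sum_mono step)
    also have "\<dots> = K * n * (1 / real n - 1 / real (max M n))"
      unfolding sum_distrib_left[symmetric] by (subst sum_lessThan_telescope') simp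
    also have "\<dots> \<le> K * n * (1 / real n)"
      using K by (intro mult_left_mono) auto
    also have "\<dots> = K" using n by simp
    finally have 1: "(\<Sum>j<M. \<bar>a j - a (Suc j)\<bar>) \<le> K" .
    have y: "x (max M n) \<ge> b" by (rule xb) simp
    have "\<bar>a M\<bar> = (sinc (x (max M n)))\<^sup>2 / (1 - sinc (x (max M n)))"
      unfolding a xs using d(2)[OF y] d(1) by simp
    also have "\<dots> \<le> 1 / d"
      using d(2)[OF y] d(1) abs_sinc_le_1[of "x (max M n)"] y b
      by (intro frac_le) (auto simp: abs_square_le_1)
    finally show "(\<Sum>j<M. \<bar>a j - a (Suc j)\<bar>) + \<bar>a M\<bar> \<le> K + 1 / d" using 1 by simp
  qed
qed

section \<open>Averages over arcs around the nodes\<close>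

text \<open>
  The indicator function of the open arc of length \<open>h\<close> centred at \<open>t\<close>. In terms of the cosine
  its periodicity and measurability are immediate.
\<close>

definition pulse :: "real \<Rightarrow> real \<Rightarrow> real \<Rightarrow> complex" where
  "pulse h t x = (if cos (h / 2) < cos (x - t) then 1 else 0)"

lemma cos_less_cos_iff:
  assumes "0 \<le> a" "a \<le> pi" "\<bar>u\<bar> \<le> pi"
  shows "cos a < cos u \<longleftrightarrow> \<bar>u\<bar> < a"
  using cos_mono_less_eq[of a "\<bar>u\<bar>"] assms by simp

lemma pulse_nonzeroE:
  assumes "pulse h t x \<noteq> 0" "0 \<le> h" "h \<le> 2 * pi"
  obtains m :: int where "\<bar>x - (t + 2 * pi * of_int m)\<bar> < h / 2"
proof -
  \<comment> \<open>Translating by the nearest multiple of the period brings \<open>x - t\<close> into \<open>{-pi..pi}\<close>.\<close>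
  define m where "m = round ((x - t) / (2 * pi))"
  define v where "v = x - (t + 2 * pi * of_int m)"
  have "\<bar>of_int m - (x - t) / (2 * pi)\<bar> \<le> 1 / 2"
    unfolding m_def by (rule of_int_round_abs_le)
  then have "\<bar>of_int m - (x - t) / (2 * pi)\<bar> * (2 * pi) \<le> 1 / 2 * (2 * pi)"
    by (intro mult_right_mono) auto
  then have "\<bar>(of_int m - (x - t) / (2 * pi)) * (2 * pi)\<bar> \<le> pi" by (simp add: abs_mult)
  moreover have "(of_int m - (x - t) / (2 * pi)) * (2 * pi) = - v"
    by (simp only: left_diff_distrib[of "of_int m"]) (simp add: v_def)
  ultimately have v: "\<bar>v\<bar> \<le> pi" by simp
  have "cos (x - t) = cos v"
    using periodic_add_int[of cos v m] by (simp add: v_def)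
  with assms(1) have "cos (h / 2) < cos v" by (auto simp: pulse_def split: if_splits)
  then have "\<bar>v\<bar> < h / 2" using assms v by (subst (asm) cos_less_cos_iff) auto
  then show ?thesis using that by (simp add: v_def)
qed

lemma circle_integrable_pulse [simp]: "circle_integrable (pulse h t)"
proof (rule circle_integrableI)
  show per: "pulse h t (x + 2 * pi) = pulse h t x" for x
    using cos_periodic[of "x - t"] by (simp add: pulse_def diff_add_eq)
  have "pulse h t \<in> borel_measurable borel" unfolding pulse_def by measurable
  then show m: "pulse h t \<in> borel_measurable lebesgue" by (simp add: measurable_completion)
  show "pulse h t absolutely_integrable_on {-pi..pi}"
  proof (rule measurable_bounded_by_integrable_imp_absolutely_integrable)
    show "pulse h t \<in> borel_measurable (lebesgue_on {-pi..pi})" using m by (rule measurable_restrict_space1)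
    show "(\<lambda>x. 1::real) integrable_on {-pi..pi}" by auto
  qed (auto simp: pulse_def)
qed

lemma fourier_coeff_pulse:
  assumes h: "0 < h" "h \<le> 2 * pi"
  shows "fourier_coeff (pulse h t) j = h / (2 * pi) * sinc (of_int j * h / 2) * cis (- (of_int j * t))"
proof -
  have "integral {-pi..pi} (\<lambda>x. pulse h t x * cis (- (of_int j * x))) =
        integral {-pi..pi} (\<lambda>x. pulse h t (x + t) * cis (- (of_int j * (x + t))))"
    by (rule integral_translate_circle[symmetric]) (intro circle_integrable_mult_cis' circle_integrable_pulse)
  also have "\<dots> = integral {-pi..pi} (\<lambda>x. if x \<in> {-h/2<..<h/2} then cis (- (of_int j * t)) * cis (of_int (-j) * x) else 0)"
  proof (rule Henstock_Kurzweil_Integration.integral_cong)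
    fix x assume "x \<in> {-pi..pi}"
    then have "\<bar>x\<bar> \<le> pi" by auto
    then have "pulse h t (x + t) = (if x \<in> {-h/2<..<h/2} then 1 else 0)"
      using cos_less_cos_iff[of "h/2" x] h by (auto simp: pulse_def)
    then show "pulse h t (x + t) * cis (- (of_int j * (x + t))) =
       (if x \<in> {-h/2<..<h/2} then cis (- (of_int j * t)) * cis (of_int (-j) * x) else 0)"
      by (simp add: cis_mult algebra_simps)
  qed
  also have "\<dots> = integral {-h/2<..<h/2} (\<lambda>x. cis (- (of_int j * t)) * cis (of_int (-j) * x))"
  proof -
    have "{-h/2<..<h/2} \<inter> {-pi..pi} = {-h/2<..<h/2}" using h by auto
    then show ?thesis by (simp only: integral_restrict_Int)
  qed
  also have "\<dots> = integral {0-h/2..0+h/2} (\<lambda>x. cis (- (of_int j * t)) * cis (of_int (-j) * x))"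
    by (simp add: integral_open_interval_real)
  also have "\<dots> = cis (- (of_int j * t)) * (h * sinc (of_int j * h / 2))"
    unfolding integral_mult_right using integral_cis[OF h(1), of 0 "of_int (-j)"] by simp
  finally show ?thesis by (simp add: fourier_coeff_def)
qed

text \<open>
  If both arcs contain \<open>x\<close>, their centres, lifted to the line, differ by less than the spacing of
  the nodes, of which the difference is an integral multiple; so it vanishes.
\<close>

lemma pulse_nodes_disjoint:
  assumes h: "0 \<le> h" "h \<le> 2 * pi / (2 * real n + 1)" and kl: "k \<le> 2 * n" "l \<le> 2 * n"
    and "pulse h (node n k) x \<noteq> 0" "pulse h (node n l) x \<noteq> 0"
  shows "k = l"
proof -
  let ?D = "2 * pi / (2 * real n + 1)"
  have "?D \<le> 2 * pi / 1" by (rule divide_left_mono) auto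
  then have "h \<le> 2 * pi" using h by simp
  then obtain p q where p: "\<bar>x - (node n k + 2 * pi * of_int p)\<bar> < h / 2"
    and q: "\<bar>x - (node n l + 2 * pi * of_int q)\<bar> < h / 2"
    using assms by (meson pulse_nonzeroE)
  define r where "r = int k - int l + (2 * int n + 1) * (p - q)"
  have node: "node n i = ?D * real i" for i by (simp add: node_def)
  have D: "?D * (2 * real n + 1) = 2 * pi" by simp
  have r': "real_of_int r = (real k - real l) + (2 * real n + 1) * (of_int p - of_int q)"
    by (simp add: r_def)
  have "?D * real_of_int r = ?D * (real k - real l) + (?D * (2 * real n + 1)) * (of_int p - of_int q)"
    unfolding r' by (simp only: distrib_left[of ?D "real k - real l"] mult.assoc)
  also have "\<dots> = (node n k + 2 * pi * of_int p) - (node n l + 2 * pi * of_int q)"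
    unfolding D node by (simp only: right_diff_distrib)
  finally have "?D * real_of_int r = (node n k + 2 * pi * of_int p) - (node n l + 2 * pi * of_int q)" .
  then have "\<bar>?D * real_of_int r\<bar> < ?D" using p q h(2) by linarith
  then have "?D * \<bar>real_of_int r\<bar> < ?D * 1" by (simp add: abs_mult)
  then have "\<bar>real_of_int r\<bar> < 1" by (subst (asm) mult_less_cancel_left_pos) auto
  then have r: "r = 0" by linarith
  then have eq: "int k - int l = (2 * int n + 1) * (q - p)" by (simp add: r_def algebra_simps)
  have "q = p"
  proof (rule ccontr)
    assume "q \<noteq> p"
    then have "(2 * int n + 1) * 1 \<le> (2 * int n + 1) * \<bar>q - p\<bar>" by (intro mult_left_mono) auto
    also have "\<dots> = \<bar>int k - int l\<bar>" unfolding eq abs_mult by simp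
    also have "\<dots> \<le> 2 * int n" using kl by auto
    finally show False by simp
  qed
  with eq show ?thesis by simp
qed

text \<open>
  The step function that on each arc of length \<open>h\<close> around a node equals the mean of \<open>f\<close> over that arc.
\<close>

definition cell_average :: "nat \<Rightarrow> real \<Rightarrow> (real \<Rightarrow> complex) \<Rightarrow> real \<Rightarrow> complex" where
  "cell_average n h f x = (\<Sum>k = 0..2 * n. steklov h f (node n k) * pulse h (node n k) x)"

lemma circle_integrable_cell_average [simp]: "circle_integrable (cell_average n h f)"
  unfolding cell_average_def[abs_def] by (intro circle_integrable_sum circle_integrable_mult_left) simp

lemma circle_integrable_cmod:
  assumes f: "circle_integrable f"
  shows "circle_integrable (\<lambda>x. complex_of_real (cmod (f x)))"
proof (rule circle_integrableI)
  have "(\<lambda>x. cmod (f x)) \<in> borel_measurable lebesgue"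
    by (rule measurable_compose[OF circle_integrable_measurable[OF f] borel_measurable_norm])
  then show "(\<lambda>x. complex_of_real (cmod (f x))) \<in> borel_measurable lebesgue"
    by (rule measurable_compose) simp
  show "(\<lambda>x. complex_of_real (cmod (f x))) absolutely_integrable_on {-pi..pi}"
    using absolutely_integrable_linear[OF absolutely_integrable_norm[OF circle_integrable_on[OF f]]
        bounded_linear_of_real]
    by (simp add: o_def)
qed (simp add: circle_integrable_periodic[OF f])

text \<open>
  An arc of length \<open>h\<close> containing \<open>x\<close> lies within distance \<open>h\<close> of \<open>x\<close>, so the mean over the arc is
  at most twice the mean over \<open>{x - h..x + h}\<close>.
\<close>

lemma cmod_cell_average_le:
  assumes f: "circle_integrable f" and h: "0 < h" "h \<le> 2 * pi / (2 * real n + 1)"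
  shows "cmod (cell_average n h f x) \<le> cmod (2 * steklov (2 * h) (\<lambda>t. complex_of_real (cmod (f t))) x)"
proof (cases "\<exists>k\<le>2 * n. pulse h (node n k) x \<noteq> 0")
  case False
  then have "cell_average n h f x = 0" unfolding cell_average_def by (intro sum.neutral) auto
  then show ?thesis by simp
next
  case True
  then obtain k where k: "k \<le> 2 * n" "pulse h (node n k) x \<noteq> 0" by blast
  have "2 * pi / (2 * real n + 1) \<le> 2 * pi / 1" by (rule divide_left_mono) auto
  then have h2: "h \<le> 2 * pi" using h by simp
  obtain m where m: "\<bar>x - (node n k + 2 * pi * of_int m)\<bar> < h / 2"
    using pulse_nonzeroE[OF k(2) _ h2] h by auto
  define t where "t = node n k + 2 * pi * of_int m"
  have "cell_average n h f x = (\<Sum>i\<in>{0..2 * n}. if i = k then steklov h f (node n k) else 0)"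
    unfolding cell_average_def
  proof (intro sum.cong refl)
    fix i assume "i \<in> {0..2 * n}"
    then have "i = k" if "pulse h (node n i) x \<noteq> 0"
      using pulse_nodes_disjoint[OF _ h(2) _ k(1) that k(2)] h by auto
    moreover have "pulse h (node n k) x = 1" using k(2) by (auto simp: pulse_def split: if_splits)
    ultimately show "steklov h f (node n i) * pulse h (node n i) x = (if i = k then steklov h f (node n k) else 0)"
      by (cases "i = k") (simp_all, blast)
  qed
  also have "\<dots> = steklov h f (node n k)" using k(1) by simp
  also have "\<dots> = steklov h f t"
    unfolding t_def using periodic_add_int[of "steklov h f", OF steklov_periodic[OF f]] by simp
  finally have "cmod (cell_average n h f x) = cmod (steklov h f t)" by simp
  also have "\<dots> = cmod (integral {t - h/2..t + h/2} f) / h"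
    using h f by (simp add: steklov_eq_integral norm_divide)
  also have "\<dots> \<le> integral {x - h..x + h} (\<lambda>s. cmod (f s)) / h"
  proof (rule divide_right_mono)
    have ni: "(\<lambda>s. cmod (f s)) integrable_on {a..b}" for a b
      using set_lebesgue_integral_eq_integral(1)[OF absolutely_integrable_norm[OF circle_integrable_on[OF f]]]
      by (simp add: o_def)
    have "cmod (integral {t - h/2..t + h/2} f) \<le> integral {t - h/2..t + h/2} (\<lambda>s. cmod (f s))"
      by (rule integral_norm_bound_integral) (use f ni in auto)
    also have "\<dots> \<le> integral {x - h..x + h} (\<lambda>s. cmod (f s))"
    proof (rule integral_subset_le)
      have "\<bar>x - t\<bar> < h / 2" using m by (simp add: t_def)
      then have "x - h \<le> t - h/2" "t + h/2 \<le> x + h" by linarith+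
      then show "{t - h/2..t + h/2} \<subseteq> {x - h..x + h}" by simp
    qed (use ni in auto)
    finally show "cmod (integral {t - h/2..t + h/2} f) \<le> integral {x - h..x + h} (\<lambda>s. cmod (f s))" .
  qed (use h in auto)
  also have "integral {x - h..x + h} (\<lambda>s. cmod (f s)) =
             cmod (integral {x - h..x + h} (\<lambda>s. complex_of_real (cmod (f s))))"
  proof -
    have ni: "(\<lambda>s. cmod (f s)) integrable_on {x - h..x + h}"
      using set_lebesgue_integral_eq_integral(1)[OF absolutely_integrable_norm[OF circle_integrable_on[OF f]]]
      by (simp add: o_def)
    have "integral {x - h..x + h} (\<lambda>s. complex_of_real (cmod (f s))) = of_real (integral {x - h..x + h} (\<lambda>s. cmod (f s)))"
      using integral_linear[OF ni, of "of_real :: real \<Rightarrow> complex"] bounded_linear_of_real by (simp add: o_def)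
    moreover have "0 \<le> integral {x - h..x + h} (\<lambda>s. cmod (f s))" using ni by (intro Henstock_Kurzweil_Integration.integral_nonneg) auto
    ultimately show ?thesis by simp
  qed
  also have "cmod (integral {x - h..x + h} (\<lambda>s. complex_of_real (cmod (f s)))) / h =
     cmod (2 * steklov (2 * h) (\<lambda>t. complex_of_real (cmod (f t))) x)"
    using h circle_integrable_cmod[OF f] by (simp add: steklov_eq_integral norm_mult norm_divide)
  finally show ?thesis .
qed

text \<open>
  The coefficient of the pulse at a node \<open>t\<close> is \<open>sinc (j * h / 2) * cis (- j * t)\<close> up to a constant,
  so the coefficients of the step function are those of the sampling operator times the \<open>sinc\<close>
  factor. As \<open>h\<close> does not exceed the spacing of the nodes, this factor is nonzero up to degree \<open>n\<close>
  and can be divided out.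
\<close>

lemma sampling_operator_eq_multiplier:
  assumes n: "n > 0" and h: "0 < h" "h \<le> 2 * pi / (2 * real n + 1)" and \<gamma>: "h = \<gamma> / real n"
  shows "sampling_operator \<gamma> n f x =
    complex_of_real (2 * pi / ((2 * real n + 1) * h)) *
      fourier_multiplier (\<lambda>j. 1 / sinc (real j * (h / 2))) n (cell_average n h f) x"
proof -
  have "2 * pi / (2 * real n + 1) \<le> 2 * pi / 1" by (rule divide_left_mono) auto
  then have h2: "h \<le> 2 * pi" using h by simp
  have coef: "fourier_coeff (cell_average n h f) j = h / (2 * pi) * sinc (of_int j * h / 2) *
      (\<Sum>k = 0..2 * n. steklov h f (node n k) * cis (- (of_int j * node n k)))" for j
    unfolding cell_average_def[abs_def]
    by (subst fourier_coeff_sum)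
       (auto simp: fourier_coeff_cmult fourier_coeff_pulse[OF h(1) h2] circle_integrable_mult_left
          sum_distrib_left mult_ac)
  have s: "complex_of_real (1 / sinc (real (nat \<bar>j\<bar>) * (h / 2))) * complex_of_real (sinc (of_int j * h / 2)) = 1"
    if "j \<in> {- int n..int n}" for j
  proof -
    have "real (nat \<bar>j\<bar>) = \<bar>real_of_int j\<bar>" by simp
    then have eq: "sinc (of_int j * h / 2) = sinc (real (nat \<bar>j\<bar>) * (h / 2))"
      by (cases "j \<ge> 0") (auto simp: sinc_minus[symmetric, of "of_int j * h / 2"] simp del: sinc_minus)
    have "real (nat \<bar>j\<bar>) * (h / 2) \<le> real n * (2 * pi / (2 * real n + 1) / 2)"
      using that h by (intro mult_mono divide_right_mono) auto
    also have "\<dots> = pi * (real n / (2 * real n + 1))" by (simp add: divide_simps)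
    also have "\<dots> < pi * 1" by (intro mult_strict_left_mono) auto
    finally have "0 < sinc (real (nat \<bar>j\<bar>) * (h / 2))"
      using h by (intro sinc_pos mult_nonneg_nonneg) simp_all
    then show ?thesis unfolding eq by simp
  qed
  have c: "complex_of_real (2 * pi / ((2 * real n + 1) * h)) * complex_of_real (h / (2 * pi)) = 1 / of_nat (2 * n + 1)"
  proof -
    have "A / (W * h) * (h / A) = 1 / W" if "A \<noteq> 0" "W \<noteq> 0" for A W :: real
      using that h by (simp add: field_simps)
    from this[of "2 * pi" "2 * real n + 1"]
    have "2 * pi / ((2 * real n + 1) * h) * (h / (2 * pi)) = 1 / (2 * real n + 1)" by simp
    then have "complex_of_real (2 * pi / ((2 * real n + 1) * h) * (h / (2 * pi))) = complex_of_real (1 / (2 * real n + 1))"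
      by (rule arg_cong)
    then show ?thesis using h by simp
  qed
  show ?thesis
    unfolding sampling_operator_trig_sum fourier_multiplier_def coef of_real_mult[of "h / (2 * pi)"] \<gamma>[symmetric]
      sum_distrib_left[of "complex_of_real (2 * pi / ((2 * real n + 1) * h))"]
  proof (intro sum.cong refl)
    fix j assume j: "j \<in> {- int n..int n}"
    let ?S = "\<Sum>k = 0..2 * n. steklov h f (node n k) * cis (- (of_int j * node n k))"
    have "complex_of_real (2 * pi / ((2 * real n + 1) * h)) *
      (complex_of_real (1 / sinc (real (nat \<bar>j\<bar>) * (h / 2))) *
        (complex_of_real (h / (2 * pi)) * complex_of_real (sinc (of_int j * h / 2)) * ?S) * cis (of_int j * x))
     = (complex_of_real (2 * pi / ((2 * real n + 1) * h)) * complex_of_real (h / (2 * pi))) *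
       (complex_of_real (1 / sinc (real (nat \<bar>j\<bar>) * (h / 2))) * complex_of_real (sinc (of_int j * h / 2))) * ?S * cis (of_int j * x)"
      by (simp only: mult_ac)
    also have "\<dots> = 1 / of_nat (2 * n + 1) * ?S * cis (of_int j * x)"
      by (simp only: s[OF j] c mult_1_right)
    finally show "1 / of_nat (2 * n + 1) * ?S * cis (of_int j * x) =
      complex_of_real (2 * pi / ((2 * real n + 1) * h)) *
      (complex_of_real (1 / sinc (real (nat \<bar>j\<bar>) * (h / 2))) *
        (complex_of_real (h / (2 * pi)) * complex_of_real (sinc (of_int j * h / 2)) * ?S) * cis (of_int j * x))"
      by (simp only: of_real_divide of_real_mult of_real_numeral mult.assoc)
  qed
qed

section \<open>Density of trigonometric polynomials\<close>

inductive trig_poly :: "(real \<Rightarrow> complex) \<Rightarrow> bool" where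
  monomial: "trig_poly (\<lambda>x. c * cis (of_int k * x))"
| add: "trig_poly p \<Longrightarrow> trig_poly q \<Longrightarrow> trig_poly (\<lambda>x. p x + q x)"

lemma trig_poly_const: "trig_poly (\<lambda>x. c)"
  using trig_poly.monomial[of c 0] by simp

lemma trig_poly_mult_monomial:
  "trig_poly p \<Longrightarrow> trig_poly (\<lambda>x. c * cis (of_int k * x) * p x)"
proof (induction rule: trig_poly.induct)
  case (monomial d j)
  have "(\<lambda>x. c * cis (of_int k * x) * (d * cis (of_int j * x))) = (\<lambda>x. c * d * cis (of_int (k + j) * x))"
  proof
    fix x
    have "cis (of_int (k + j) * x) = cis (of_int k * x) * cis (of_int j * x)"
      by (simp add: cis_mult distrib_right)
    then show "c * cis (of_int k * x) * (d * cis (of_int j * x)) = c * d * cis (of_int (k + j) * x)"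
      by simp
  qed
  then show ?case by (simp only: trig_poly.monomial)
next
  case (add p q)
  then show ?case using trig_poly.add by (simp add: distrib_left)
qed

lemma trig_poly_mult:
  "trig_poly p \<Longrightarrow> trig_poly q \<Longrightarrow> trig_poly (\<lambda>x. p x * q x)"
proof (induction rule: trig_poly.induct)
  case (monomial c k)
  then show ?case by (rule trig_poly_mult_monomial)
next
  case (add p q)
  then show ?case using trig_poly.add by (simp add: distrib_right)
qed

lemma trig_poly_of_real_polynomial_function:
  "real_polynomial_function r \<Longrightarrow> trig_poly (\<lambda>x. complex_of_real (r (cis x)))"
proof (induction rule: real_polynomial_function.induct)
  case (linear r)
  have "complex_of_real (r (cis x)) =
      (r 1 / 2 - \<i> * (r \<i> / 2)) * cis (of_int 1 * x) + (r 1 / 2 + \<i> * (r \<i> / 2)) * cis (of_int (-1) * x)" for x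
  proof -
    interpret bounded_linear r by (rule linear)
    have "cis x = cos x *\<^sub>R 1 + sin x *\<^sub>R \<i>" by (simp add: complex_eq_iff)
    then have "r (cis x) = cos x * r 1 + sin x * r \<i>" by (simp only: add scaleR real_scaleR_def)
    then show ?thesis by (simp add: complex_eq_iff field_simps)
  qed
  then show ?case by (simp only: trig_poly.intros)
next
  case (const c)
  show ?case by (rule trig_poly_const)
next
  case (add f g)
  then show ?case using trig_poly.add by simp
next
  case (mult f g)
  then show ?case using trig_poly_mult by simp
qed

text \<open>
  Transported to the unit circle by the argument, \<open>w\<close> is approximated by a polynomial in the real
  and imaginary part (Stone--Weierstrass), and such polynomials are trigonometric in the angle. Periodicity
  removes the jump of the argument: off the origin \<open>w\<close> composed with either branch is the same
  function, and each point has a branch that is continuous there.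
\<close>

lemma trig_poly_dense:
  fixes w :: "real \<Rightarrow> complex"
  assumes cont: "continuous_on UNIV w" and per: "\<And>x. w (x + 2 * pi) = w x" and e: "0 < e"
  obtains p where "trig_poly p" "\<And>x. cmod (w x - p x) < e"
proof -
  have wcont: "isCont w x" for x using cont by (simp add: continuous_on_eq_continuous_at)
  have Arg_cis: "w (Arg (cis x)) = w x" for x
  proof -
    have "cis (Arg (cis x)) = cis x" by (simp add: cis_Arg sgn_div_norm)
    then have "sin (Arg (cis x)) = sin x" "cos (Arg (cis x)) = cos x"
      by (metis cis.sel)+
    then obtain m :: int where "Arg (cis x) = x + 2 * pi * m" using sin_cos_eq_iff[of "Arg (cis x)" x] by auto
    then show ?thesis using periodic_add_int[of w, OF per, of x m] by simp
  qed
  have Arg2pi_cis: "w (Arg2pi z) = w (Arg z)" if "z \<noteq> 0" for z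
  proof -
    have "cis (Arg2pi z) = cis (Arg z)"
      using that Arg_eq[of z] Arg2pi_eq[of z] by (simp add: cis_conv_exp) (metis mult_cancel_left norm_eq_zero of_real_eq_0_iff)
    then show ?thesis using Arg_cis by metis
  qed
  have "isCont (\<lambda>z. w (Arg z)) z" if "z \<noteq> 0" for z
  proof (cases "z \<in> \<real>\<^sub>\<le>\<^sub>0")
    case False
    then show ?thesis by (intro isCont_o2[OF continuous_at_Arg] wcont)
  next
    case True
    then have "z \<notin> \<real>\<^sub>\<ge>\<^sub>0" using that by (auto simp: complex_nonneg_Reals_iff complex_nonpos_Reals_iff complex_eq_iff)
    then have "isCont (\<lambda>z. w (Arg2pi z)) z" by (intro isCont_o2[OF continuous_at_Arg2pi] wcont)
    moreover have "\<forall>\<^sub>F u in nhds z. w (Arg2pi u) = w (Arg u)"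
    proof -
      have "\<forall>\<^sub>F u in nhds z. u \<in> - {0}"
        by (rule eventually_nhds_in_open) (use that in auto)
      then show ?thesis by eventually_elim (simp add: Arg2pi_cis)
    qed
    ultimately show ?thesis using isCont_cong by fast
  qed
  note contArg = this
  have "continuous_on (sphere 0 1) (\<lambda>z. w (Arg z))"
  proof (intro continuous_at_imp_continuous_on ballI)
    fix z :: complex assume "z \<in> sphere 0 1"
    then have "z \<noteq> 0" by auto
    then show "isCont (\<lambda>z. w (Arg z)) z" by (rule contArg)
  qed
  then obtain g where g: "polynomial_function g" "\<And>z. z \<in> sphere 0 1 \<Longrightarrow> cmod (w (Arg z) - g z) < e"
    using Stone_Weierstrass_polynomial_function[of "sphere (0::complex) 1" "\<lambda>z. w (Arg z)" e] e by auto
  have "real_polynomial_function (Re \<circ> g)" "real_polynomial_function (Im \<circ> g)"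
    using g(1) bounded_linear_Re bounded_linear_Im unfolding polynomial_function_def by blast+
  then have "trig_poly (\<lambda>x. complex_of_real ((Re \<circ> g) (cis x)))" "trig_poly (\<lambda>x. complex_of_real ((Im \<circ> g) (cis x)))"
    by (auto dest: trig_poly_of_real_polynomial_function)
  then have "trig_poly (\<lambda>x. complex_of_real (Re (g (cis x))) + \<i> * complex_of_real (Im (g (cis x))))"
    by (auto intro!: trig_poly.add trig_poly_mult trig_poly_const)
  then have "trig_poly (\<lambda>x. g (cis x))" by (simp flip: complex_eq)
  moreover have "cmod (w x - g (cis x)) < e" for x
    using g(2)[of "cis x"] by (simp add: Arg_cis)
  ultimately show ?thesis using that by blast
qed

lemma fourier_sum_add:
  "circle_integrable f \<Longrightarrow> circle_integrable g \<Longrightarrow>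
   fourier_sum n (\<lambda>x. f x + g x) x = fourier_sum n f x + fourier_sum n g x"
  by (simp add: fourier_sum_def fourier_coeff_add distrib_right sum.distrib)

lemma fourier_sum_diff:
  "circle_integrable f \<Longrightarrow> circle_integrable g \<Longrightarrow>
   fourier_sum n (\<lambda>x. f x - g x) x = fourier_sum n f x - fourier_sum n g x"
  by (simp add: fourier_sum_def fourier_coeff_diff left_diff_distrib sum_subtractf)

lemma fourier_sum_cmult: "fourier_sum n (\<lambda>x. c * f x) x = c * fourier_sum n f x"
  by (simp add: fourier_sum_def fourier_coeff_cmult sum_distrib_left mult.assoc)

lemma trig_poly_circle_integrable: "trig_poly p \<Longrightarrow> circle_integrable p"
  by (induction rule: trig_poly.induct) auto

lemma trig_poly_fourier_sum:
  "trig_poly p \<Longrightarrow> \<exists>n. \<forall>M\<ge>n. fourier_sum M p = p"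
proof (induction rule: trig_poly.induct)
  case (monomial c k)
  show ?case
  proof (intro exI[of _ "nat \<bar>k\<bar>"] allI impI ext)
    fix M x assume "nat \<bar>k\<bar> \<le> M"
    then have k: "k \<in> {- int M..int M}" by auto
    have "fourier_sum M (\<lambda>x. c * cis (of_int k * x)) x =
       (\<Sum>j = - int M..int M. if j = k then c * cis (of_int k * x) else 0)"
      unfolding fourier_sum_def fourier_coeff_cmult fourier_coeff_cis by (intro sum.cong) auto
    also have "\<dots> = c * cis (of_int k * x)" using k by simp
    finally show "fourier_sum M (\<lambda>x. c * cis (of_int k * x)) x = c * cis (of_int k * x)" .
  qed
next
  case (add p q)
  then obtain m n where mn: "\<forall>M\<ge>m. fourier_sum M p = p" "\<forall>M\<ge>n. fourier_sum M q = q" by blast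
  have "fourier_sum M (\<lambda>x. p x + q x) = (\<lambda>x. p x + q x)" if "M \<ge> max m n" for M
    using mn that add.hyps by (intro ext) (simp add: fourier_sum_add trig_poly_circle_integrable)
  then show ?case by (intro exI[of _ "max m n"] allI impI)
qed

section \<open>Banach lattices on the circle\<close>

context banach_lattice_on_circle
begin

lemma emeasure_circle_measure_finite: "emeasure circle_measure UNIV < \<infinity>"
proof -
  have "emeasure circle_measure UNIV = 1"
    unfolding circle_measure_def by (subst emeasure_uniform_measure) (auto simp: divide_ennreal)
  then show ?thesis by simp
qed

lemma one_measurable: "(\<lambda>x. 1) \<in> circle_measurable"
  unfolding circle_measurable_def periodic_fun_simple_def by simp

lemma one_mem: "(\<lambda>x. 1) \<in> X"
  using indicator_mem[of UNIV] one_measurable emeasure_circle_measure_finite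
  by simp

text \<open>
  The embedding of \<open>X\<close> into the integrable functions. It gives access to Fourier coefficients, and
  it bounds the partial sum of order 0, about which the hypothesis on the Dirichlet kernels is
  silent.
\<close>

lemma circle_nn_integral_bound:
  obtains c where "0 < c"
    "\<And>f. f \<in> X \<Longrightarrow> (\<integral>\<^sup>+x. ennreal (cmod (f x)) * indicator {-pi..<pi} x \<partial>lebesgue) \<le> ennreal (c * N f)"
proof -
  obtain c where c: "c > 0" "\<And>f. f \<in> X \<Longrightarrow> (\<integral>\<^sup>+x\<in>UNIV. ennreal (cmod (f x)) \<partial>circle_measure) \<le> ennreal (c * N f)"
    using integral_bound[of UNIV] one_measurable emeasure_circle_measure_finite
    by auto
  show ?thesis
  proof (rule that[of "2 * pi * c"])
    show "0 < 2 * pi * c" using c by simp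
    fix f assume f: "f \<in> X"
    let ?I = "\<integral>\<^sup>+x. ennreal (cmod (f x)) * indicator {-pi..<pi} x \<partial>lebesgue"
    have m: "(\<lambda>x. ennreal (cmod (f x))) \<in> borel_measurable lebesgue"
      using f measurable measurable_compose[of f lebesgue borel "\<lambda>z. ennreal (cmod z)" borel]
      unfolding circle_measurable_def by auto
    have "?I / ennreal (2 * pi) = (\<integral>\<^sup>+x\<in>UNIV. ennreal (cmod (f x)) \<partial>circle_measure)"
      unfolding circle_measure_def by (subst nn_integral_uniform_measure) (use m in auto)
    also have "\<dots> \<le> ennreal (c * N f)" by (rule c(2)[OF f])
    finally have "?I / ennreal (2 * pi) * ennreal (2 * pi) \<le> ennreal (c * N f) * ennreal (2 * pi)"
      by (rule mult_right_mono) simp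
    also have "?I / ennreal (2 * pi) * ennreal (2 * pi) = ?I"
      by (intro ennreal_divide_times[THEN trans] mult_divide_eq_ennreal) auto
    also have "ennreal (c * N f) * ennreal (2 * pi) = ennreal (2 * pi * c * N f)"
      using c norm_nonneg[OF f] by (subst ennreal_mult[symmetric]) (auto simp: mult_ac)
    finally show "?I \<le> ennreal (2 * pi * c * N f)" .
  qed
qed

lemma mem_circle_integrable:
  assumes f: "f \<in> X"
  shows "circle_integrable f"
proof -
  obtain c where c: "c > 0" 
    "(\<integral>\<^sup>+x. ennreal (cmod (f x)) * indicator {-pi..<pi} x \<partial>lebesgue) \<le> ennreal (c * N f)"
    using circle_nn_integral_bound f by metis
  have fm: "f \<in> circle_measurable" using f measurable by auto
  then have m: "f \<in> borel_measurable lebesgue" unfolding circle_measurable_def by blast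
  have "f absolutely_integrable_on {-pi..<pi}"
    unfolding set_integrable_def
  proof (rule integrableI_bounded)
    show "(\<lambda>x. indicat_real {- pi..<pi} x *\<^sub>R f x) \<in> borel_measurable lebesgue"
      using m by (intro borel_measurable_scaleR borel_measurable_indicator) auto
    have "(\<integral>\<^sup>+x. ennreal (norm (indicat_real {- pi..<pi} x *\<^sub>R f x)) \<partial>lebesgue) =
       (\<integral>\<^sup>+x. ennreal (cmod (f x)) * indicator {-pi..<pi} x \<partial>lebesgue)"
      by (intro nn_integral_cong) (auto simp: indicator_def)
    also have "\<dots> < \<infinity>" using c(2) by (rule order_le_less_trans) simp
    finally show "(\<integral>\<^sup>+x. ennreal (norm (indicat_real {- pi..<pi} x *\<^sub>R f x)) \<partial>lebesgue) < \<infinity>" .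
  qed
  moreover have "{-pi..<pi} \<union> {pi..pi} = {-pi..pi}" by auto
  moreover have "f absolutely_integrable_on {pi..pi}"
    using absolutely_integrable_on_null[of pi pi f] by simp
  ultimately have "f absolutely_integrable_on {-pi..pi}"
    by (metis absolutely_integrable_Un)
  with fm show ?thesis by (simp add: circle_integrable_def)
qed

lemma fourier_coeff_bound:
  obtains c where "0 < c" "\<And>f k. f \<in> X \<Longrightarrow> cmod (fourier_coeff f k) \<le> c * N f"
proof -
  obtain c where c: "c > 0" 
    "\<And>f. f \<in> X \<Longrightarrow> (\<integral>\<^sup>+x. ennreal (cmod (f x)) * indicator {-pi..<pi} x \<partial>lebesgue) \<le> ennreal (c * N f)"
    using circle_nn_integral_bound by blast
  show ?thesis
  proof (rule that[OF c(1)])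
    fix f k assume f: "f \<in> X"
    let ?g = "\<lambda>x. f x * cis (- (of_int k * x))"
    have g: "circle_integrable ?g" using mem_circle_integrable[OF f] by (rule circle_integrable_mult_cis')
    have gi: "?g absolutely_integrable_on {-pi..<pi}"
      by (rule set_integrable_subset[OF circle_integrable_on[OF g, of "-pi" pi]]) auto
    have "integral {-pi..pi} ?g = integral {-pi..<pi} ?g"
      by (rule integral_subset_negligible[symmetric]) (auto intro: negligible_subset[of "{pi}"])
    also have "\<dots> = (LINT x:{-pi..<pi}|lebesgue. ?g x)"
      by (rule set_lebesgue_integral_eq_integral(2)[OF gi, symmetric])
    finally have "ennreal (cmod (integral {-pi..pi} ?g)) = ennreal (cmod (LINT x:{-pi..<pi}|lebesgue. ?g x))" by simp
    also have "\<dots> \<le> (\<integral>\<^sup>+x. ennreal (norm (indicat_real {- pi..<pi} x *\<^sub>R ?g x)) \<partial>lebesgue)"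
      unfolding set_lebesgue_integral_def
      by (rule integral_norm_bound_ennreal) (use gi in \<open>simp add: set_integrable_def\<close>)
    also have "\<dots> = (\<integral>\<^sup>+x. ennreal (cmod (f x)) * indicator {-pi..<pi} x \<partial>lebesgue)"
      by (intro nn_integral_cong) (auto simp: indicator_def norm_mult)
    also have "\<dots> \<le> ennreal (c * N f)" by (rule c(2)[OF f])
    finally have "cmod (integral {-pi..pi} ?g) \<le> c * N f"
      using c(1) norm_nonneg[OF f] by (subst (asm) ennreal_le_iff) auto
    moreover have "cmod (integral {-pi..pi} ?g) / (2 * pi) \<le> cmod (integral {-pi..pi} ?g) / 1"
      using pi_gt3 by (intro divide_left_mono) auto
    ultimately show "cmod (fourier_coeff f k) \<le> c * N f"
      by (simp add: fourier_coeff_def norm_divide norm_mult)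
  qed
qed

lemma diff_closed: "f \<in> X \<Longrightarrow> g \<in> X \<Longrightarrow> (\<lambda>x. f x - g x) \<in> X"
  using add_closed[OF _ scale_closed[of g "-1"], of f] by simp

lemma norm_diff_le: "f \<in> X \<Longrightarrow> g \<in> X \<Longrightarrow> N (\<lambda>x. f x - g x) \<le> N f + N g"
  using norm_triangle[OF _ scale_closed[of g "-1"], of f] norm_scale[of g "-1"] by simp

lemma zero_mem: "(\<lambda>x. 0) \<in> X" and norm_zero: "N (\<lambda>x. 0) = 0"
  using scale_closed[OF one_mem, of 0] norm_scale[OF one_mem, of 0] by simp_all

lemma sum_mem_norm_le:
  assumes "finite I" "\<And>i. i \<in> I \<Longrightarrow> g i \<in> X"
  shows "(\<lambda>x. \<Sum>i\<in>I. g i x) \<in> X \<and> N (\<lambda>x. \<Sum>i\<in>I. g i x) \<le> (\<Sum>i\<in>I. N (g i))"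
  using assms
proof (induction I rule: finite_induct)
  case empty
  then show ?case by (simp add: zero_mem norm_zero)
next
  case (insert i I)
  then have "(\<lambda>x. g i x + (\<Sum>i\<in>I. g i x)) \<in> X"
    "N (\<lambda>x. g i x + (\<Sum>i\<in>I. g i x)) \<le> N (g i) + (\<Sum>i\<in>I. N (g i))"
    using norm_triangle[of "g i" "\<lambda>x. \<Sum>i\<in>I. g i x"] by (auto intro: add_closed)
  then show ?case using insert.hyps by simp
qed

lemma bounded_mem_norm_le:
  assumes "f \<in> circle_measurable" "0 \<le> B" "\<And>x. cmod (f x) \<le> B"
  shows "f \<in> X \<and> N f \<le> B * N (\<lambda>x. 1)"
proof -
  have "f \<in> X \<and> N f \<le> N (\<lambda>x. complex_of_real B * 1)"
    by (rule ideal[OF assms(1) scale_closed[OF one_mem]]) (use assms in simp)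
  then show ?thesis using norm_scale[OF one_mem, of "complex_of_real B"] assms(2) by simp
qed

lemma continuous_mem:
  assumes u: "continuous_on UNIV u" and per: "\<And>x. u (x + 2 * pi) = u x"
  shows "u \<in> X"
proof -
  have "bounded (u ` {-pi..pi})"
    by (intro compact_imp_bounded compact_continuous_image continuous_on_subset[OF u]) auto
  then obtain B where B: "\<forall>y\<in>u ` {-pi..pi}. norm y \<le> B" unfolding bounded_iff by blast
  have "cmod (u x) \<le> B" for x
  proof -
    define m where "m = \<lfloor>(x + pi) / (2 * pi)\<rfloor>"
    have "of_int m \<le> (x + pi) / (2 * pi)" "(x + pi) / (2 * pi) < of_int m + 1"
      unfolding m_def by linarith+
    then have "x + 2 * pi * of_int (- m) \<in> {-pi..pi}" by (auto simp: field_simps)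
    then have "cmod (u (x + 2 * pi * of_int (- m))) \<le> B" using B by blast
    then show ?thesis using periodic_add_int[of u, OF per, of x "- m"] by simp
  qed
  moreover have "0 \<le> B" using calculation[of 0] norm_ge_zero order_trans by blast
  moreover have "u \<in> circle_measurable"
    using circle_integrable_continuous[OF u per] by (simp add: circle_integrable_def)
  ultimately show ?thesis using bounded_mem_norm_le by blast
qed

lemma trig_sum_mem: "(\<lambda>x. \<Sum>k\<in>S. c k * cis (of_int k * x)) \<in> X"
proof (rule continuous_mem)
  show "continuous_on UNIV (\<lambda>x. \<Sum>k\<in>S. c k * cis (of_int k * x))"
    by (intro continuous_intros)
qed (simp only: cis_int_periodic)

lemma fourier_sum_mem [simp]: "fourier_sum n f \<in> X"
  unfolding fourier_sum_def[abs_def] by (rule trig_sum_mem)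

lemma sampling_operator_mem [simp]: "sampling_operator \<gamma> n f \<in> X"
  unfolding sampling_operator_trig_sum[abs_def] by (rule trig_sum_mem)

text \<open>
  The usual rescaling by \<open>1 / N f\<close> fails if \<open>N f = 0\<close>; then all multiples of \<open>f\<close> lie in the unit
  ball, which forces \<open>N (T f) = 0\<close>.
\<close>

lemma homogeneous_bound:
  assumes mem: "T f \<in> X" and hom: "\<And>c. T (\<lambda>x. c * f x) = (\<lambda>x. c * T f x)"
    and le: "\<And>g. g \<in> X \<Longrightarrow> N g \<le> 1 \<Longrightarrow> N (T g) \<le> C" and f: "f \<in> X"
  shows "N (T f) \<le> C * N f"
proof -
  have scaled: "r * N (T f) \<le> C" if "r \<ge> 0" "r * N f \<le> 1" for r
  proof -
    have "N (T (\<lambda>x. complex_of_real r * f x)) \<le> C"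
      using that f by (intro le scale_closed) (simp_all add: norm_scale)
    then show ?thesis using that mem by (simp add: hom norm_scale)
  qed
  show ?thesis
  proof (cases "N f = 0")
    case True
    have "N (T f) \<le> 0"
    proof (rule ccontr)
      assume "\<not> N (T f) \<le> 0"
      then have "(\<bar>C\<bar> + 1) / N (T f) * N (T f) \<le> C"
        using True by (intro scaled) auto
      then show False using \<open>\<not> N (T f) \<le> 0\<close> by simp
    qed
    then show ?thesis using True by simp
  next
    case False
    then have "N f > 0" using norm_nonneg[OF f] by simp
    then have "1 / N f * N (T f) \<le> C" by (intro scaled) auto
    then show ?thesis using \<open>N f > 0\<close> by (simp add: field_simps)
  qed
qed

lemma steklov_bounded:
  assumes A: "assumption_A X N"
  obtains C where "0 < C" "\<And>f h. f \<in> X \<Longrightarrow> 0 < h \<Longrightarrow> steklov h f \<in> X"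
    "\<And>f h. f \<in> X \<Longrightarrow> 0 < h \<Longrightarrow> N (steklov h f) \<le> C * N f"
proof -
  let ?S = "SUP h\<in>{0<..}. SUP f\<in>{f \<in> X. N f \<le> 1}. ereal (N (steklov h f))"
  have mem: "steklov h f \<in> X" if "f \<in> X" "0 < h" for f h
    using A that by (simp add: assumption_A_def)
  have "?S < \<infinity>" using A by (simp add: assumption_A_def)
  then obtain C0 where C0: "?S \<le> ereal C0"
    by (cases ?S) (auto intro: that[of 0])
  define C where "C = max C0 1"
  have C: "?S \<le> ereal C" using C0 by (rule order_trans) (simp add: C_def)
  have le: "N (steklov h f) \<le> C" if "f \<in> X" "N f \<le> 1" "h > 0" for f h
  proof -
    have "ereal (N (steklov h f)) \<le> (SUP f\<in>{f \<in> X. N f \<le> 1}. ereal (N (steklov h f)))"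
      using that by (intro SUP_upper) auto
    also have "\<dots> \<le> ?S" using that by (intro SUP_upper) auto
    also note C
    finally show ?thesis by simp
  qed
  show ?thesis
  proof (rule that[OF _ mem])
    show "0 < C" by (simp add: C_def)
    fix f h assume f: "f \<in> X" and h: "(0::real) < h"
    show "N (steklov h f) \<le> C * N f"
      by (rule homogeneous_bound[of "steklov h"])
         (use f h mem le in \<open>auto simp: steklov_cmult[OF mem_circle_integrable[OF f]]\<close>)
  qed
qed

lemma fourier_sum_bounded:
  assumes D: "(SUP n\<in>{1..}. SUP f\<in>{f \<in> X. N f \<le> 1}. ereal (N (convolution f (dirichlet_kernel n)))) < \<infinity>"
  obtains C where "0 < C" "\<And>f n. f \<in> X \<Longrightarrow> N (fourier_sum n f) \<le> C * N f"
proof -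
  let ?S = "SUP n\<in>{1..}. SUP f\<in>{f \<in> X. N f \<le> 1}. ereal (N (convolution f (dirichlet_kernel n)))"
  obtain C0 where C0: "?S \<le> ereal C0"
    using D by (cases ?S) (auto intro: that[of 0])
  obtain c where c: "0 < c" "\<And>f k. f \<in> X \<Longrightarrow> cmod (fourier_coeff f k) \<le> c * N f"
    using fourier_coeff_bound by blast
  \<comment> \<open>The second argument serves order 0, where the partial sum is the constant mean value.\<close>
  define C where "C = max C0 (c * N (\<lambda>x. 1) + 1)"
  have n1: "0 \<le> N (\<lambda>x. 1)" by (rule norm_nonneg[OF one_mem])
  have C: "?S \<le> ereal C" using C0 by (rule order_trans) (simp add: C_def)
  show ?thesis
  proof (rule that[of C])
    show "0 < C" using c n1 by (simp add: C_def max.strict_coboundedI2 add_nonneg_pos)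
    fix f n assume f: "f \<in> X"
    show "N (fourier_sum n f) \<le> C * N f"
    proof (cases "n = 0")
      case True
      have "fourier_sum n f = (\<lambda>x. fourier_coeff f 0 * 1)"
        by (rule ext) (simp add: fourier_sum_def True)
      then have "N (fourier_sum n f) = cmod (fourier_coeff f 0) * N (\<lambda>x. 1)"
        by (simp only: norm_scale[OF one_mem])
      also have "\<dots> \<le> c * N f * N (\<lambda>x. 1)" by (intro mult_right_mono c f n1)
      also have "\<dots> = (c * N (\<lambda>x. 1)) * N f" by simp
      also have "\<dots> \<le> C * N f" using norm_nonneg[OF f] by (intro mult_right_mono) (auto simp: C_def)
      finally show ?thesis .
    next
      case False
      have le: "N (fourier_sum n g) \<le> C" if "g \<in> X" "N g \<le> 1" for g
      proof -
        have "ereal (N (convolution g (dirichlet_kernel n))) \<le>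
            (SUP f\<in>{f \<in> X. N f \<le> 1}. ereal (N (convolution f (dirichlet_kernel n))))"
          using that by (intro SUP_upper) auto
        also have "\<dots> \<le> ?S" using False by (intro SUP_upper) auto
        also note C
        finally show ?thesis
          using convolution_dirichlet_kernel[OF mem_circle_integrable[OF that(1)]] by simp
      qed
      show ?thesis
        by (rule homogeneous_bound[of "fourier_sum n"]) (use f le in \<open>auto simp: fourier_sum_cmult\<close>)
    qed
  qed
qed

lemma multiplier_bound:
  assumes C: "0 < C" "\<And>f n. f \<in> X \<Longrightarrow> N (fourier_sum n f) \<le> C * N f" and f: "f \<in> X"
  shows "N (fourier_multiplier a M f) \<le> C * ((\<Sum>j<M. \<bar>a j - a (Suc j)\<bar>) + \<bar>a M\<bar>) * N f"
proof -
  let ?g = "\<lambda>j x. complex_of_real (a j - a (Suc j)) * fourier_sum j f x"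
  have eq: "fourier_multiplier a M f = (\<lambda>x. (\<Sum>j<M. ?g j x) + a M * fourier_sum M f x)"
    by (rule ext) (rule fourier_multiplier_by_parts)
  have S: "(\<lambda>x. \<Sum>j<M. ?g j x) \<in> X" "N (\<lambda>x. \<Sum>j<M. ?g j x) \<le> (\<Sum>j<M. N (?g j))"
    using sum_mem_norm_le[of "{..<M}" ?g] by (simp_all only: finite_lessThan scale_closed fourier_sum_mem)
  have "N (fourier_multiplier a M f) \<le> (\<Sum>j<M. N (?g j)) + N (\<lambda>x. a M * fourier_sum M f x)"
    unfolding eq using norm_triangle[OF S(1) scale_closed[OF fourier_sum_mem], of "complex_of_real (a M)" M f] S(2) by linarith
  also have "\<dots> = (\<Sum>j<M. \<bar>a j - a (Suc j)\<bar> * N (fourier_sum j f)) + \<bar>a M\<bar> * N (fourier_sum M f)"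
    by (simp only: norm_scale[OF fourier_sum_mem] norm_of_real)
  also have "\<dots> \<le> (\<Sum>j<M. \<bar>a j - a (Suc j)\<bar> * (C * N f)) + \<bar>a M\<bar> * (C * N f)"
    by (intro add_mono sum_mono mult_left_mono C f) auto
  also have "\<dots> = C * ((\<Sum>j<M. \<bar>a j - a (Suc j)\<bar>) + \<bar>a M\<bar>) * N f"
    by (simp add: sum_distrib_right distrib_left distrib_right sum_distrib_left mult_ac)
  finally show ?thesis .
qed

text \<open>
  Let a trigonometric polynomial \<open>p\<close> be uniformly close to \<open>w\<close>. Constants belong to \<open>X\<close>, so \<open>p\<close> is
  close to \<open>w\<close> in norm; for large \<open>M\<close> the partial sum of order \<open>M\<close> fixes \<open>p\<close>, and the uniform bound
  makes the partial sum of \<open>w - p\<close> small.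
\<close>

lemma norm_le_of_fourier_sums:
  assumes C: "0 < C" "\<And>f n. f \<in> X \<Longrightarrow> N (fourier_sum n f) \<le> C * N f"
    and cont: "continuous_on UNIV w" and per: "\<And>x. w (x + 2 * pi) = w x"
    and B: "\<And>M. n \<le> M \<Longrightarrow> N (fourier_sum M w) \<le> B"
  shows "N w \<le> B"
proof (rule field_le_epsilon)
  fix e :: real assume e: "0 < e"
  define N1 where "N1 = N (\<lambda>x. 1)"
  have N1: "0 \<le> N1" unfolding N1_def by (rule norm_nonneg[OF one_mem])
  \<comment> \<open>The summand 1 keeps the denominator positive even when \<open>N1 = 0\<close>.\<close>
  define d where "d = e / ((1 + C) * (N1 + 1))"
  have d: "0 < d" using e C(1) N1 by (simp add: d_def)
  obtain p where p: "trig_poly p" "\<And>x. cmod (w x - p x) < d"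
    using trig_poly_dense[OF cont per d] by blast
  obtain m where m: "\<forall>M\<ge>m. fourier_sum M p = p" using trig_poly_fourier_sum[OF p(1)] by blast
  define M where "M = max n m"
  have w: "circle_integrable w" "w \<in> X" using cont per by (auto intro: circle_integrable_continuous continuous_mem)
  have pX: "p \<in> X" using m by (metis fourier_sum_mem order_refl)
  have pc: "circle_integrable p" by (rule trig_poly_circle_integrable[OF p(1)])
  let ?r = "\<lambda>x. w x - p x"
  have r: "?r \<in> X" by (rule diff_closed[OF w(2) pX])
  have Nr: "N ?r \<le> d * N1"
    unfolding N1_def using r measurable p(2) d by (intro conjunct2[OF bounded_mem_norm_le]) (auto intro: less_imp_le)
  have "w = (\<lambda>x. fourier_sum M w x + (?r x - fourier_sum M ?r x))"
    using m by (intro ext) (simp add: fourier_sum_diff w pc M_def)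
  then have "N w \<le> N (fourier_sum M w) + N (\<lambda>x. ?r x - fourier_sum M ?r x)"
    using norm_triangle[OF fourier_sum_mem diff_closed[OF r fourier_sum_mem], of M w M ?r] by simp
  also have "\<dots> \<le> B + (N ?r + N (fourier_sum M ?r))"
    by (intro add_mono B norm_diff_le r fourier_sum_mem) (simp add: M_def)
  also have "\<dots> \<le> B + (1 + C) * N ?r" using C(2)[OF r, of M] by (simp add: distrib_right)
  also have "\<dots> \<le> B + (1 + C) * (d * N1)" using C(1) Nr by simp
  also have "(1 + C) * (d * N1) = e * (N1 / (N1 + 1))"
    using C(1) N1 by (simp add: d_def)
  also have "\<dots> \<le> e * 1" using e N1 by (intro mult_left_mono) auto
  finally show "N w \<le> B + e" by simp
qed

end

section \<open>Approximation by the sampling operator\<close>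

lemma fourier_coeff_fourier_sum:
  "fourier_coeff (fourier_sum n f) k = (if \<bar>k\<bar> \<le> int n then fourier_coeff f k else 0)"
  unfolding fourier_sum_def[abs_def] by (subst fourier_coeff_trig_sum) auto

lemma steklov_fourier_sum:
  assumes f: "circle_integrable f" and h: "0 < h"
  shows "steklov h (fourier_sum n f) x = fourier_sum n (steklov h f) x"
  unfolding fourier_sum_def
  by (subst steklov_trig_sum) (simp_all add: h fourier_coeff_steklov[OF f h] mult_ac)

lemma sampling_operator_sampling_operator:
  assumes "0 < \<gamma> / real n"
  shows "sampling_operator \<gamma> n (sampling_operator \<gamma> n f) x = steklov (\<gamma> / real n) (sampling_operator \<gamma> n f) x"
  unfolding sampling_operator_trig_sum[of \<gamma> n f, abs_def]
  by (rule sampling_operator_of_trig_poly[OF assms])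

lemma sampling_operator_fourier_sum:
  assumes "0 < \<gamma> / real n"
  shows "sampling_operator \<gamma> n (fourier_sum n f) x = steklov (\<gamma> / real n) (fourier_sum n f) x"
  unfolding fourier_sum_def[abs_def] by (rule sampling_operator_of_trig_poly[OF assms])

context banach_lattice_on_circle
begin

text \<open>
  The lattice property is used twice: \<open>\<bar>f\<bar>\<close> has at most the norm of \<open>f\<close>, and domination by the
  Steklov average of \<open>\<bar>f\<bar>\<close> passes to norms.
\<close>

lemma cell_average_bound:
  assumes A: "\<And>f h. f \<in> X \<Longrightarrow> 0 < h \<Longrightarrow> steklov h f \<in> X"
      "\<And>f h. f \<in> X \<Longrightarrow> 0 < h \<Longrightarrow> N (steklov h f) \<le> CA * N f"
    and CA: "0 < CA"
    and f: "f \<in> X" and h: "0 < h" "h \<le> 2 * pi / (2 * real n + 1)"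
  shows "cell_average n h f \<in> X \<and> N (cell_average n h f) \<le> 2 * CA * N f"
proof -
  let ?F = "\<lambda>x. complex_of_real (cmod (f x))"
  note fc = mem_circle_integrable[OF f]
  have F: "?F \<in> X" "N ?F \<le> N f"
    using ideal[of ?F f] circle_integrable_cmod[OF fc] f by (auto simp: circle_integrable_def)
  have S: "steklov (2 * h) ?F \<in> X" using A(1)[OF F(1)] h by simp
  have "cell_average n h f \<in> X \<and> N (cell_average n h f) \<le> N (\<lambda>x. 2 * steklov (2 * h) ?F x)"
  proof (rule ideal)
    show "cell_average n h f \<in> circle_measurable"
      using circle_integrable_cell_average[of n h f] unfolding circle_integrable_def by blast
    show "(\<lambda>x. 2 * steklov (2 * h) ?F x) \<in> X" using S by (rule scale_closed)
    show "AE x in circle_measure. cmod (cell_average n h f x) \<le> cmod (2 * steklov (2 * h) ?F x)"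
      by (intro AE_I2 cmod_cell_average_le fc h)
  qed
  moreover have "N (\<lambda>x. 2 * steklov (2 * h) ?F x) = 2 * N (steklov (2 * h) ?F)"
    using norm_scale[OF S, of 2] by simp
  moreover have "N (steklov (2 * h) ?F) \<le> CA * N ?F" using A(2)[OF F(1)] h by simp
  moreover have "CA * N ?F \<le> CA * N f" using F(2) CA by simp
  ultimately show ?thesis by auto
qed

text \<open>
  The multiplier \<open>1 / sinc (j * h / 2)\<close> ends at \<open>1 / sinc (\<gamma> / 2)\<close> for every \<open>n\<close>, because
  \<open>n * h = \<gamma>\<close>; the separation condition for \<open>n = 1\<close> keeps \<open>\<gamma> / 2\<close> below \<open>pi\<close>.
\<close>

lemma sampling_operator_bounded:
  assumes A: "\<And>f h. f \<in> X \<Longrightarrow> 0 < h \<Longrightarrow> steklov h f \<in> X"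
      "\<And>f h. f \<in> X \<Longrightarrow> 0 < h \<Longrightarrow> N (steklov h f) \<le> CA * N f" "0 < CA"
    and S: "0 < CS" "\<And>f n. f \<in> X \<Longrightarrow> N (fourier_sum n f) \<le> CS * N f"
    and \<gamma>: "0 < \<gamma>" "\<And>n. 0 < n \<Longrightarrow> \<gamma> / real n \<le> 2 * pi / (2 * real n + 1)"
  obtains C where "0 < C" "\<And>f n. f \<in> X \<Longrightarrow> 0 < n \<Longrightarrow> N (sampling_operator \<gamma> n f) \<le> C * N f"
proof -
  have "\<gamma> * 3 \<le> 2 * pi" using \<gamma>(2)[of 1] by simp
  then have "\<gamma> / 2 < pi" using pi_gt_zero by linarith
  then have s: "0 < sinc (\<gamma> / 2)" using \<gamma>(1) by (intro sinc_pos) auto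
  show ?thesis
  proof (rule that[of "pi / \<gamma> * (CS * (2 / sinc (\<gamma> / 2)) * (2 * CA))"])
    show "0 < pi / \<gamma> * (CS * (2 / sinc (\<gamma> / 2)) * (2 * CA))"
      using A(3) S(1) \<gamma>(1) s by (intro mult_pos_pos divide_pos_pos) auto
    fix f n assume f: "f \<in> X" and n: "(0::nat) < n"
    define h where "h = \<gamma> / real n"
    have h: "0 < h" "h \<le> 2 * pi / (2 * real n + 1)" using n \<gamma> by (simp_all add: h_def)
    have nh: "real n * (h / 2) = \<gamma> / 2" using n by (simp add: h_def)
    define a where "a = (\<lambda>j. 1 / sinc (real j * (h / 2)))"
    define c where "c = 2 * pi / ((2 * real n + 1) * h)"
    have c: "0 \<le> c" "c \<le> pi / \<gamma>"
    proof -
      show "0 \<le> c" using h by (simp add: c_def)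
      have "c \<le> 2 * pi / (2 * real n * h)"
        unfolding c_def using h n by (intro divide_left_mono mult_right_mono mult_pos_pos) auto
      also have "\<dots> = pi / \<gamma>" using n \<gamma>(1) by (simp add: h_def)
      finally show "c \<le> pi / \<gamma>" .
    qed
    have E: "cell_average n h f \<in> X" "N (cell_average n h f) \<le> 2 * CA * N f"
      using cell_average_bound[OF A f h] by auto
    have V: "(\<Sum>j<n. \<bar>a j - a (Suc j)\<bar>) + \<bar>a n\<bar> \<le> 2 / sinc (\<gamma> / 2)"
      using inverse_sinc_variation[of "h / 2" n] h \<open>\<gamma> / 2 < pi\<close> unfolding nh a_def by simp
    have mX: "fourier_multiplier a n (cell_average n h f) \<in> X"
      unfolding fourier_multiplier_def[abs_def] by (rule trig_sum_mem)
    have "sampling_operator \<gamma> n f = (\<lambda>x. complex_of_real c * fourier_multiplier a n (cell_average n h f) x)"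
      using sampling_operator_eq_multiplier[OF n h h_def] by (intro ext) (simp only: a_def c_def)
    then have "N (sampling_operator \<gamma> n f) = c * N (fourier_multiplier a n (cell_average n h f))"
      using norm_scale[OF mX, of "complex_of_real c"] c(1) by simp
    also have "\<dots> \<le> c * (CS * ((\<Sum>j<n. \<bar>a j - a (Suc j)\<bar>) + \<bar>a n\<bar>) * N (cell_average n h f))"
      by (intro mult_left_mono multiplier_bound S E c)
    also have "\<dots> \<le> pi / \<gamma> * (CS * (2 / sinc (\<gamma> / 2)) * (2 * CA * N f))"
      using S(1) s c E norm_nonneg[OF E(1)] norm_nonneg[OF f] A(3) \<gamma>(1) V
      by (intro mult_mono mult_nonneg_nonneg) auto
    finally show "N (sampling_operator \<gamma> n f) \<le> pi / \<gamma> * (CS * (2 / sinc (\<gamma> / 2)) * (2 * CA)) * N f"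
      by (simp add: mult_ac)
  qed
qed

text \<open>
  A Jackson-type inequality. Write \<open>v\<close> for the remainder and \<open>G = v - A v\<close>. Applying
  \<open>v = G + A v\<close> twice gives \<open>v = G + A G + A (A v)\<close>, and the last term is obtained from \<open>G\<close> by the multiplier
  \<open>sinc\<^sup>2 / (1 - sinc)\<close>, which has finite variation on the frequencies above \<open>n\<close>, the only
  ones present.
\<close>

lemma fourier_remainder_bound:
  assumes A: "\<And>f h. f \<in> X \<Longrightarrow> 0 < h \<Longrightarrow> steklov h f \<in> X"
      "\<And>f h. f \<in> X \<Longrightarrow> 0 < h \<Longrightarrow> N (steklov h f) \<le> CA * N f" "0 < CA"
    and S: "0 < CS" "\<And>f n. f \<in> X \<Longrightarrow> N (fourier_sum n f) \<le> CS * N f"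
    and \<gamma>: "0 < \<gamma>"
  obtains C where "0 < C"
    "\<And>f n. f \<in> X \<Longrightarrow> 0 < n \<Longrightarrow>
       N (\<lambda>x. f x - fourier_sum n f x) \<le> C * N (\<lambda>x. f x - steklov (\<gamma> / real n) f x)"
proof -
  obtain V where V: "0 < V"
    "\<And>n M a. 0 < n \<Longrightarrow>
       a = (\<lambda>j. (sinc (real (max j n) * (\<gamma> / 2 / real n)))\<^sup>2 / (1 - sinc (real (max j n) * (\<gamma> / 2 / real n)))) \<Longrightarrow>
       (\<Sum>j<M. \<bar>a j - a (Suc j)\<bar>) + \<bar>a M\<bar> \<le> V"
    using sinc_tail_variation[of "\<gamma> / 2"] \<gamma> by auto
  show ?thesis
  proof (rule that[of "(1 + CA + CS * V) * (1 + CS)"])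
    show "0 < (1 + CA + CS * V) * (1 + CS)" using V(1) S(1) A(3) by (simp add: add_pos_pos)
    fix f n assume f: "f \<in> X" and n: "(0::nat) < n"
    define h where "h = \<gamma> / real n"
    have h: "0 < h" using n \<gamma> by (simp add: h_def)
    define v where "v = (\<lambda>x. f x - fourier_sum n f x)"
    define g where "g = (\<lambda>x. f x - steklov h f x)"
    define G where "G = (\<lambda>x. v x - steklov h v x)"
    define w where "w = steklov h (steklov h v)"
    note fc = mem_circle_integrable[OF f]
    have vX: "v \<in> X" unfolding v_def by (intro diff_closed f fourier_sum_mem)
    have gX: "g \<in> X" unfolding g_def by (intro diff_closed f A h)
    have GX: "G \<in> X" unfolding G_def by (intro diff_closed vX A h)
    note vc = mem_circle_integrable[OF vX]
    note svc = circle_integrable_steklov[OF vc h]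
    have G: "G = (\<lambda>x. g x - fourier_sum n g x)"
    proof
      fix x
      have "steklov h v x = steklov h f x - fourier_sum n (steklov h f) x"
        unfolding v_def by (simp add: steklov_diff fc steklov_fourier_sum[OF fc h])
      moreover have "fourier_sum n g x = fourier_sum n f x - fourier_sum n (steklov h f) x"
        unfolding g_def using fc h by (intro fourier_sum_diff) auto
      ultimately show "G x = g x - fourier_sum n g x" by (simp add: G_def g_def v_def)
    qed
    define s where "s = (\<lambda>k::int. sinc (of_int k * h / 2))"
    have cv: "fourier_coeff v k = 0" if "\<bar>k\<bar> \<le> int n" for k
      unfolding v_def using that by (simp add: fourier_coeff_diff fc fourier_coeff_fourier_sum)
    have cw: "fourier_coeff w k = (s k)\<^sup>2 * fourier_coeff v k" for k
      unfolding w_def by (simp add: fourier_coeff_steklov vc svc h s_def power2_eq_square)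
    have cG: "fourier_coeff G k = (1 - s k) * fourier_coeff v k" for k
      unfolding G_def by (simp add: fourier_coeff_diff vc svc fourier_coeff_steklov h s_def left_diff_distrib)
    define a where "a = (\<lambda>j. (sinc (real (max j n) * (\<gamma> / 2 / real n)))\<^sup>2 / (1 - sinc (real (max j n) * (\<gamma> / 2 / real n))))"
    have aw: "a (nat \<bar>k\<bar>) * fourier_coeff G k = fourier_coeff w k" for k
    proof (cases "\<bar>k\<bar> \<le> int n")
      case True
      then show ?thesis by (simp add: cw cG cv)
    next
      case False
      then have "n < nat \<bar>k\<bar>" by linarith
      then have "n < nat \<bar>k\<bar>" by linarith
      then have "n < nat \<bar>k\<bar>" by linarith
      then have "n < nat \<bar>k\<bar>" by linarith
      then have "n < nat \<bar>k\<bar>" by linarith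
      then have "n < nat \<bar>k\<bar>" by linarith
      then have "n < nat \<bar>k\<bar>" by linarith
      then have "n < nat \<bar>k\<bar>" by linarith
      then have "real (max (nat \<bar>k\<bar>) n) = \<bar>of_int k\<bar>" by (simp add: max_def)
      then have "sinc (real (max (nat \<bar>k\<bar>) n) * (\<gamma> / 2 / real n)) = sinc (\<bar>of_int k\<bar> * h / 2)"
        by (simp add: h_def mult.commute[of 2])
      also have sk: "\<dots> = s k"
        unfolding s_def by (cases "k \<ge> 0") (auto simp: sinc_minus[symmetric, of "of_int k * h / 2"] simp del: sinc_minus)
      finally have "a (nat \<bar>k\<bar>) = (s k)\<^sup>2 / (1 - s k)" by (simp add: a_def)
      moreover have "s k < 1"
      proof -
        have "0 < \<bar>real_of_int k\<bar> * h / 2" using False h by auto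
        then show ?thesis unfolding sk[symmetric] by (rule sinc_less_1)
      qed
      ultimately show ?thesis by (simp add: cw cG)
    qed
    have Sw: "fourier_sum M w = fourier_multiplier a M G" for M
      by (rule ext) (simp only: fourier_sum_def fourier_multiplier_def aw)
    have Nw: "N w \<le> CS * V * N G"
    proof (rule norm_le_of_fourier_sums[OF S])
      show "continuous_on UNIV w" unfolding w_def by (rule continuous_steklov[OF svc h])
      show "w (x + 2 * pi) = w x" for x unfolding w_def by (rule steklov_periodic[OF svc])
      fix M
      have "N (fourier_sum M w) \<le> CS * ((\<Sum>j<M. \<bar>a j - a (Suc j)\<bar>) + \<bar>a M\<bar>) * N G"
        unfolding Sw by (rule multiplier_bound[OF S GX])
      also have "\<dots> \<le> CS * V * N G"
        using V(2)[OF n a_def] S(1) norm_nonneg[OF GX] by (intro mult_right_mono mult_left_mono) auto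
      finally show "N (fourier_sum M w) \<le> CS * V * N G" .
    qed
    have sG: "steklov h G \<in> X" and wX: "w \<in> X" unfolding w_def by (intro A vX GX h)+
    have "v = (\<lambda>x. G x + (steklov h G x + w x))"
    proof
      fix x
      have "steklov h G x = steklov h v x - w x"
        unfolding G_def w_def by (rule steklov_diff[OF vc svc])
      then show "v x = G x + (steklov h G x + w x)" by (simp add: G_def)
    qed
    then have "N v \<le> N G + (N (steklov h G) + N w)"
      using norm_triangle[OF GX add_closed[OF sG wX]] norm_triangle[OF sG wX] by simp
    also have "\<dots> \<le> N G + (CA * N G + CS * V * N G)"
      using A(2)[OF GX h] Nw by simp
    also have "\<dots> = (1 + CA + CS * V) * N G" by (simp add: algebra_simps)
    also have "\<dots> \<le> (1 + CA + CS * V) * ((1 + CS) * N g)"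
    proof (rule mult_left_mono)
      have "N G \<le> N g + N (fourier_sum n g)" unfolding G by (intro norm_diff_le gX fourier_sum_mem)
      then show "N G \<le> (1 + CS) * N g" using S(2)[OF gX, of n] by (simp add: distrib_right)
    qed (use V(1) S(1) A(3) in \<open>simp add: add_nonneg_nonneg\<close>)
    finally show "N (\<lambda>x. f x - fourier_sum n f x) \<le> (1 + CA + CS * V) * (1 + CS) * N (\<lambda>x. f x - steklov (\<gamma> / real n) f x)"
      unfolding v_def g_def h_def by (simp only: mult.assoc)
  qed
qed

end

theorem proposition3p5:
  fixes X :: "(real \<Rightarrow> complex) set" and N :: "(real \<Rightarrow> complex) \<Rightarrow> real" and \<gamma> :: real
  assumes "banach_lattice_on_circle X N"
    and "assumption_A X N"
    and "\<gamma> > 0"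
    and "\<And>n k :: nat. n \<ge> 1 \<Longrightarrow> \<gamma> / real n \<le> node n (Suc k) - node n k"
    and "(SUP n\<in>{1..}. SUP f\<in>{f \<in> X. N f \<le> 1}. ereal (N (convolution f (dirichlet_kernel n)))) < \<infinity>"
  shows "\<exists>c>0. \<exists>C>0. \<forall>f\<in>X. \<forall>n::nat. n \<ge> 1 \<longrightarrow>
    c * N (\<lambda>x. f x - steklov (\<gamma> / real n) f x) \<le> N (\<lambda>x. f x - sampling_operator \<gamma> n f x) \<and>
    N (\<lambda>x. f x - sampling_operator \<gamma> n f x) \<le> C * N (\<lambda>x. f x - steklov (\<gamma> / real n) f x)"
proof -
  interpret banach_lattice_on_circle X N by fact
  note \<gamma> = \<open>\<gamma> > 0\<close>
  obtain CA where A: "\<And>f h. f \<in> X \<Longrightarrow> 0 < h \<Longrightarrow> steklov h f \<in> X"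
      "\<And>f h. f \<in> X \<Longrightarrow> 0 < h \<Longrightarrow> N (steklov h f) \<le> CA * N f" "0 < CA"
    using steklov_bounded[OF assms(2)] by metis
  obtain CS where S: "0 < CS" "\<And>f n. f \<in> X \<Longrightarrow> N (fourier_sum n f) \<le> CS * N f"
    using fourier_sum_bounded[OF assms(5)] by blast
  have sep: "\<gamma> / real n \<le> 2 * pi / (2 * real n + 1)" if "0 < n" for n
  proof -
    have "node n (Suc 0) - node n 0 = 2 * pi / (2 * real n + 1)" by (simp add: node_def)
    then show ?thesis using assms(4)[of n 0] that by simp
  qed
  obtain CK where K: "0 < CK" "\<And>f n. f \<in> X \<Longrightarrow> 0 < n \<Longrightarrow> N (sampling_operator \<gamma> n f) \<le> CK * N f"
    using sampling_operator_bounded[OF A S \<gamma> sep] by blast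
  obtain CR where R: "0 < CR" "\<And>f n. f \<in> X \<Longrightarrow> 0 < n \<Longrightarrow>
      N (\<lambda>x. f x - fourier_sum n f x) \<le> CR * N (\<lambda>x. f x - steklov (\<gamma> / real n) f x)"
    using fourier_remainder_bound[OF A S \<gamma>] by blast
  define C1 where "C1 = 1 + CA + CK"
  define C2 where "C2 = (1 + CK) * CR + CS"
  have C1: "0 < C1" using A(3) K(1) by (simp add: C1_def)
  have C2: "0 < C2" using R(1) K(1) S(1) by (simp add: C2_def add_pos_pos)
  have "1 / C1 * N (\<lambda>x. f x - steklov (\<gamma> / real n) f x) \<le> N (\<lambda>x. f x - sampling_operator \<gamma> n f x) \<and>
    N (\<lambda>x. f x - sampling_operator \<gamma> n f x) \<le> C2 * N (\<lambda>x. f x - steklov (\<gamma> / real n) f x)"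
    if f: "f \<in> X" and "n \<ge> 1" for f and n :: nat
  proof
    have n: "0 < n" using that by simp
    define h where "h = \<gamma> / real n"
    have h: "0 < h" using n \<gamma> by (simp add: h_def)
    let ?K = "sampling_operator \<gamma> n" and ?A = "steklov h" and ?S = "fourier_sum n"
    note fc = mem_circle_integrable[OF f]
    have AX: "?A f \<in> X" by (rule A(1)[OF f h])
    have KA: "?K (?K f) x = ?A (?K f) x" for x
      using sampling_operator_sampling_operator[of \<gamma> n f x] h by (simp add: h_def)
    define u where "u = (\<lambda>x. f x - ?K f x)"
    have uX: "u \<in> X" unfolding u_def by (intro diff_closed f sampling_operator_mem)
    have "(\<lambda>x. f x - ?A f x) = (\<lambda>x. (u x - ?A u x) + ?K u x)"
    proof
      fix x
      have "?A u x = ?A f x - ?A (?K f) x"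
        unfolding u_def by (rule steklov_diff[OF fc]) simp
      moreover have "?K u x = ?K f x - ?K (?K f) x"
        unfolding u_def by (rule sampling_operator_diff[OF fc]) simp
      ultimately show "f x - ?A f x = (u x - ?A u x) + ?K u x" by (simp add: u_def KA)
    qed
    then have "N (\<lambda>x. f x - ?A f x) \<le> N (\<lambda>x. u x - ?A u x) + N (?K u)"
      using norm_triangle[OF diff_closed[OF uX A(1)[OF uX h]] sampling_operator_mem] by simp
    also have "\<dots> \<le> (N u + CA * N u) + CK * N u"
      using norm_diff_le[OF uX A(1)[OF uX h]] A(2)[OF uX h] K(2)[OF uX n] by linarith
    also have "\<dots> = C1 * N u" by (simp add: C1_def algebra_simps)
    finally show "1 / C1 * N (\<lambda>x. f x - steklov (\<gamma> / real n) f x) \<le> N (\<lambda>x. f x - ?K f x)"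
      using C1 unfolding u_def h_def by (simp add: pos_divide_le_eq mult.commute)
    define v where "v = (\<lambda>x. f x - ?S f x)"
    define g where "g = (\<lambda>x. f x - ?A f x)"
    have vX: "v \<in> X" unfolding v_def by (intro diff_closed f fourier_sum_mem)
    have gX: "g \<in> X" unfolding g_def by (intro diff_closed f AX)
    have "(\<lambda>x. f x - ?K f x) = (\<lambda>x. (v x - ?K v x) + ?S g x)"
    proof
      fix x
      have "?K v x = ?K f x - ?K (?S f) x"
        unfolding v_def by (rule sampling_operator_diff[OF fc]) simp
      moreover have "?K (?S f) x = ?S (?A f) x"
        using sampling_operator_fourier_sum[of \<gamma> n f x] steklov_fourier_sum[OF fc h, of n x] h by (simp add: h_def)
      moreover have "?S g x = ?S f x - ?S (?A f) x"
        unfolding g_def by (rule fourier_sum_diff[OF fc circle_integrable_steklov[OF fc h]])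
      ultimately show "f x - ?K f x = (v x - ?K v x) + ?S g x" by (simp add: v_def)
    qed
    then have "N (\<lambda>x. f x - ?K f x) \<le> N (\<lambda>x. v x - ?K v x) + N (?S g)"
      using norm_triangle[OF diff_closed[OF vX sampling_operator_mem] fourier_sum_mem] by simp
    also have "\<dots> \<le> (N v + CK * N v) + CS * N g"
      using norm_diff_le[OF vX sampling_operator_mem, of \<gamma> n v] K(2)[OF vX n] S(2)[OF gX, of n] by linarith
    also have "\<dots> = (1 + CK) * N v + CS * N g" by (simp add: algebra_simps)
    also have "\<dots> \<le> (1 + CK) * (CR * N g) + CS * N g"
      using R(2)[OF f n] K(1) unfolding v_def g_def h_def by simp
    also have "\<dots> = C2 * N g" by (simp add: C2_def algebra_simps)
    finally show "N (\<lambda>x. f x - ?K f x) \<le> C2 * N (\<lambda>x. f x - steklov (\<gamma> / real n) f x)"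
      unfolding g_def h_def .
  qed
  moreover have "0 < 1 / C1" using C1 by simp
  ultimately show ?thesis using C2 by blast
qed

end
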